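(* The constant $\mu=\inf\{z\in\mathbb{R} : [z,+\infty)\subset\overline{\Omega}\}$ satisfies $$\mu\le \frac{19425+111\sqrt{26565}}{2030}\ (\approx 18.4811).$$
   Context: For irrational $\alpha$ with ordinary (regular) continued fraction expansion $\alpha=[x_0;x_1,x_2,\dots]$ ($x_0\in\mathbb{Z}$, $x_i\in\mathbb{Z}_{>0}$ for $i\ge 1$), define $$\rho(\alpha)=\limsup_{n\to\infty}\bigl([x_n;x_{n-1},\dots,x_0]\cdot[x_{n+1};x_{n+2},\dots]\bigr),$$ where $[x_n;x_{n-1},\dots,x_0]$ is the finite continued fraction with the entries in that order (the last entry $x_0$ does not influence the limsup and may be omitted when $x_0\le 0$). Put $\overline{\Omega}=\{\rho(\alpha) : \alpha\in\mathbb{R}\setminus\mathbb{Q}\}$; only finite values of $\rho$ are relevant. *)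

theory Defs
  imports Complex_Main "HOL-Library.Extended_Real"
begin

fun cf :: "real list \<Rightarrow> real" where
  "cf [] = 0"
| "cf [x] = x"
| "cf (x # y # ys) = x + 1 / cf (y # ys)"

definition cf_inf :: "(nat \<Rightarrow> real) \<Rightarrow> real" where
  "cf_inf x = lim (\<lambda>n. cf (map x [0..<Suc n]))"

text \<open>The regular continued fraction algorithm. For irrational \<open>\<alpha>\<close> no complete quotient
  is an integer, so the algorithm never divides by zero.\<close>

fun complete_quotient :: "real \<Rightarrow> nat \<Rightarrow> real" where
  "complete_quotient \<alpha> 0 = \<alpha>"
| "complete_quotient \<alpha> (Suc n) = 1 / frac (complete_quotient \<alpha> n)"

definition partial_quotient :: "real \<Rightarrow> nat \<Rightarrow> int" where
  "partial_quotient \<alpha> n = \<lfloor>complete_quotient \<alpha> n\<rfloor>"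

text \<open>The reversed list \<open>x\<^sub>n, x\<^sub>n\<^sub>-\<^sub>1, \<dots>, x\<^sub>0\<close>. The last entry \<open>x\<^sub>0\<close> is omitted when it is not positive,
  so that all entries are positive and no convention for division by zero
  enters; this does not change the limit superior below. (For \<open>n = 0\<close> and \<open>x\<^sub>0 \<le> 0\<close>
  the list is empty.)\<close>

definition backward_quotients :: "real \<Rightarrow> nat \<Rightarrow> int list" where
  "backward_quotients \<alpha> n =
     map (partial_quotient \<alpha>) (rev [(if partial_quotient \<alpha> 0 > 0 then 0 else 1)..<Suc n])"

definition rho :: "real \<Rightarrow> ereal" where
  "rho \<alpha> = limsup (\<lambda>n. ereal (cf (map real_of_int (backward_quotients \<alpha> n)) *
                                cf_inf (\<lambda>i. real_of_int (partial_quotient \<alpha> (n + 1 + i)))))"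

definition Omega_bar :: "real set" where
  "Omega_bar = {r. \<exists>\<alpha>. \<alpha> \<notin> \<rat> \<and> rho \<alpha> = ereal r}"

text \<open>The infimum is taken in the extended reals: over the empty set it is \<open>\<infinity>\<close>, whereas
  the infimum of an empty set of reals is unspecified.\<close>

definition mu :: ereal where
  "mu = (INF z \<in> {z :: real. {z..} \<subseteq> Omega_bar}. ereal z)"

text \<open>The partial quotients do form a regular continued fraction expansion of \<open>\<alpha>\<close>.\<close>

lemma complete_quotient_irrational:
  assumes "\<alpha> \<notin> \<rat>"
  shows "complete_quotient \<alpha> n \<notin> \<rat>"
proof (induction n)
  case 0
  then show ?case using assms by simp
next
  case (Suc n)
  show ?case
  proof
    assume "complete_quotient \<alpha> (Suc n) \<in> \<rat>"
    then have "1 / complete_quotient \<alpha> (Suc n) \<in> \<rat>" by (intro Rats_divide) auto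
    then have "frac (complete_quotient \<alpha> n) + of_int \<lfloor>complete_quotient \<alpha> n\<rfloor> \<in> \<rat>"
      by (intro Rats_add) auto
    then show False using Suc by (simp add: frac_def)
  qed
qed

lemma complete_quotient_gt_1:
  assumes "\<alpha> \<notin> \<rat>"
  shows "complete_quotient \<alpha> (Suc n) > 1"
proof -
  have "complete_quotient \<alpha> n \<notin> \<int>"
    using complete_quotient_irrational[OF assms] Ints_subset_Rats by blast
  then have "0 < frac (complete_quotient \<alpha> n)" by (simp add: frac_gt_0_iff)
  then show ?thesis using frac_lt_1[of "complete_quotient \<alpha> n"] by simp
qed

lemma partial_quotient_ge_1:
  assumes "\<alpha> \<notin> \<rat>"
  shows "partial_quotient \<alpha> (Suc n) \<ge> 1"
  using complete_quotient_gt_1[OF assms, of n] by (simp add: partial_quotient_def le_floor_iff del: complete_quotient.simps)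

lemma complete_quotient_shift:
  "complete_quotient (complete_quotient \<alpha> m) n = complete_quotient \<alpha> (m + n)"
  by (induction n) auto

lemma cf_ge_1: "xs \<noteq> [] \<Longrightarrow> (\<And>x. x \<in> set xs \<Longrightarrow> x \<ge> 1) \<Longrightarrow> cf xs \<ge> 1"
proof (induction xs rule: cf.induct)
  case (3 x y ys)
  then have "cf (y # ys) \<ge> 1" by simp
  then have "1 / cf (y # ys) \<ge> 0" by simp
  moreover have "x \<ge> 1" using 3 by simp
  ultimately have "x + 1 / cf (y # ys) \<ge> 1" by linarith
  then show ?case by simp
qed auto

lemma cf_map_Suc:
  "cf (map x [0..<Suc (Suc n)]) = x 0 + 1 / cf (map (\<lambda>i. x (Suc i)) [0..<Suc n])"
proof -
  have "map x [0..<Suc (Suc n)] = x 0 # map (\<lambda>i. x (Suc i)) [0..<Suc n]"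
    by (simp only: upt_conv_Cons[OF zero_less_Suc] map_Suc_upt[symmetric] list.map map_map o_def)
  moreover have "map (\<lambda>i. x (Suc i)) [0..<Suc n] = x 1 # map (\<lambda>i. x (Suc i)) [1..<Suc n]"
    by (simp add: upt_conv_Cons del: upt_Suc)
  ultimately show ?thesis by (simp only: cf.simps)
qed

lemma cf_partial_quotient_error:
  assumes "\<alpha> \<notin> \<rat>"
  shows "\<bar>cf (map (\<lambda>i. real_of_int (partial_quotient \<alpha> i)) [0..<Suc n]) - \<alpha>\<bar> \<le> 2 * (1/2) ^ n"
  using assms
proof (induction n arbitrary: \<alpha> rule: less_induct)
  case (less n)
  define c where "c = (\<lambda>k m. cf (map (\<lambda>i. real_of_int (partial_quotient \<alpha> (k + i))) [0..<Suc m]))"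
  define q where "q = complete_quotient \<alpha>"
  have irr: "q k \<notin> \<rat>" for k
    unfolding q_def by (rule complete_quotient_irrational[OF less.prems])
  have q_gt: "q (Suc k) > 1" for k
    unfolding q_def by (rule complete_quotient_gt_1[OF less.prems])
  have q_step: "q k = real_of_int (partial_quotient \<alpha> k) + 1 / q (Suc k)" for k
    unfolding q_def partial_quotient_def by (simp add: frac_def)
  have c_ge: "c (Suc k) m \<ge> 1" for k m
    unfolding c_def using partial_quotient_ge_1[OF less.prems] by (intro cf_ge_1) auto
  have c_step: "c k (Suc m) = real_of_int (partial_quotient \<alpha> k) + 1 / c (Suc k) m" for k m
    unfolding c_def by (subst cf_map_Suc) simp
  have shift: "c k m = cf (map (\<lambda>i. real_of_int (partial_quotient (q k) i)) [0..<Suc m])" for k m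
    unfolding c_def q_def partial_quotient_def by (simp add: complete_quotient_shift)
  have contract: "\<bar>c k (Suc m) - q k\<bar> = \<bar>c (Suc k) m - q (Suc k)\<bar> / (c (Suc k) m * q (Suc k))" for k m
  proof -
    have pos: "c (Suc k) m > 0" "q (Suc k) > 0"
      using c_ge[of k m] q_gt[of k] by auto
    have "c k (Suc m) - q k = (q (Suc k) - c (Suc k) m) / (c (Suc k) m * q (Suc k))"
      using pos unfolding c_step q_step[of k] by (simp add: field_simps)
    then show ?thesis using pos by (simp add: abs_minus_commute)
  qed
  have base: "\<bar>c k 0 - q k\<bar> \<le> 1" for k
    unfolding c_def q_def partial_quotient_def by simp linarith
  have goal: "\<bar>c 0 n - q 0\<bar> \<le> 2 * (1/2) ^ n"
  proof (cases n)
    case 0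
    then show ?thesis using base[of 0] by simp
  next
    case (Suc n')
    show ?thesis
    proof (cases n')
      case 0
      have "\<bar>c 1 0 - q 1\<bar> / (c 1 0 * q 1) \<le> 1 / 1"
        using base[of 1] c_ge[of 0 0] q_gt[of 0]
        by (intro frac_le) (auto simp: mult_ge1_I)
      then show ?thesis using contract[of 0 0] Suc 0 by simp
    next
      case (Suc m)
      have n: "n = Suc (Suc m)" using Suc \<open>n = Suc n'\<close> by simp
      have pos: "c 2 m \<ge> 1" "q 2 > 1" using c_ge[of 1 m] q_gt[of 1] by (auto simp: numeral_2_eq_2)
      have "1 * 1 \<le> real_of_int (partial_quotient \<alpha> 1) * c 2 m"
        using partial_quotient_ge_1[OF less.prems, of 0] pos by (intro mult_mono) auto
      then have A: "c 1 (Suc m) * c 2 m \<ge> 2"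
        using pos c_step[of 1 m] by (simp add: algebra_simps numeral_2_eq_2)
      have "1 * 1 \<le> real_of_int (partial_quotient \<alpha> 1) * q 2"
        using partial_quotient_ge_1[OF less.prems, of 0] pos by (intro mult_mono) auto
      then have B: "q 1 * q 2 \<ge> 2"
        using pos q_step[of 1] by (simp add: algebra_simps numeral_2_eq_2)
      have "2 * 2 \<le> (c 1 (Suc m) * c 2 m) * (q 1 * q 2)"
        using A B by (intro mult_mono) auto
      then have D: "4 \<le> (c 2 m * q 2) * (c 1 (Suc m) * q 1)" by (simp add: mult_ac)
      have IH: "\<bar>c 2 m - q 2\<bar> \<le> 2 * (1/2) ^ m"
        using less.IH[of m "q 2"] irr n unfolding shift by simp
      have "\<bar>c 0 n - q 0\<bar> = \<bar>c 2 m - q 2\<bar> / ((c 2 m * q 2) * (c 1 (Suc m) * q 1))"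
        using contract[of 0 "Suc m"] contract[of 1 m] n by (simp add: numeral_2_eq_2)
      also have "\<dots> \<le> (2 * (1/2) ^ m) / 4"
        using IH D by (intro frac_le) auto
      finally show ?thesis using n by simp
    qed
  qed
  then show ?case unfolding c_def q_def by simp
qed

lemma cf_partial_quotient_tendsto:
  assumes "\<alpha> \<notin> \<rat>"
  shows "(\<lambda>n. cf (map (\<lambda>i. real_of_int (partial_quotient \<alpha> i)) [0..<Suc n])) \<longlonglongrightarrow> \<alpha>"
    (is "?f \<longlonglongrightarrow> _")
proof -
  define f where "f = ?f"
  have bound: "\<bar>f n - \<alpha>\<bar> \<le> 2 * (1/2) ^ n" for n
    unfolding f_def by (rule cf_partial_quotient_error[OF assms])
  have "(\<lambda>n. (1/2) ^ n :: real) \<longlonglongrightarrow> 0"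
    by (rule LIMSEQ_realpow_zero) simp_all
  then have lim: "(\<lambda>n. 2 * (1/2) ^ n :: real) \<longlonglongrightarrow> 0"
    by (rule tendsto_mult_right_zero)
  have "(\<lambda>n. \<bar>f n - \<alpha>\<bar>) \<longlonglongrightarrow> 0"
    by (rule tendsto_sandwich[OF _ _ tendsto_const lim]) (simp_all add: bound)
  then have "f \<longlonglongrightarrow> \<alpha>"
    by (simp only: tendsto_rabs_zero_iff LIM_zero_iff)
  then show ?thesis by (simp only: f_def)
qed

lemma cf_inf_partial_quotient:
  assumes "\<alpha> \<notin> \<rat>"
  shows "cf_inf (\<lambda>i. real_of_int (partial_quotient \<alpha> i)) = \<alpha>"
  unfolding cf_inf_def by (rule limI) (rule cf_partial_quotient_tendsto[OF assms])

end

theory Submission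
  imports Defs "HOL-Library.Sublist" "HOL-Library.Discrete_Functions"
begin

text \<open>
  The words over the digits 1, 2, 3, 4 without \<open>44\<close> and without \<open>41414\<close> serve as background. The largest
  product of two facing continued fractions in such a word has the form \<open>[4; \<dots>] \<cdot> [3; \<dots>]\<close>; avoiding
  \<open>41414\<close> bounds it by \<open>[4; 1, 4, 1, 3, 1, \<dots>] \<cdot> [3; 1, 4, 1, 4, 1, \<dots>]\<close> (both periodic), which is exactly
  the constant of the theorem. On the other hand these words still form a Cantor set that, in the coordinate
  \<open>ln (a + x)\<close> with \<open>a \<ge> 4\<close>, has thickness at least 1: every gap is at most as long as the two
  neighbouring pieces. As in Hall's theorem the sums of two such sets are intervals, so every
  \<open>z \<ge> 18.2\<close> is a product \<open>(a + u) (b + v)\<close> with \<open>a, b \<ge> 4\<close> and background words \<open>u\<close>, \<open>v\<close>. An expansion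
  containing longer and longer windows of the bi-infinite word \<open>u\<^sup>R a b v\<close>, separated by the digit 2,
  has limit superior \<open>z\<close>: the products at the pairs \<open>a b\<close> tend to \<open>z\<close>, they dominate the two
  neighbouring ones, and all others are background products.
\<close>


text \<open>Two demands compete: each forbidden word lowers the background bound but thins the
  Cantor set. The constant of the theorem is set by the background alone; sums of logarithms already
  cover everything from 18.2 on. A peak with \<open>a = b = 4\<close> itself contains
  \<open>44\<close>, so the outer bound may rely only on the absence of \<open>41414\<close>.
  Reading the words as if a 4 preceded them keeps that pattern out even across a peak. Every
  cylinder is the image of a fixed interval under some map
  \<open>(p + p' * t) / (q + q' * t)\<close>. Infinitely many maps occur, but
  \<open>p' \<le> p\<close> and \<open>q' \<le> q\<close> hold for all of them, and this makes the
  comparisons uniform: thickness reduces to twelve pairs of a state and a digit with rational end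
  points. One pair fails in the plain coordinate; there the last digit 1 follows a digit at least 4,
  which forces enough concavity of the logarithm. The sum argument refines a pair of intervals such
  that neither is shorter than the gap of the other. For this to persist, gaps must also not grow
  from a node to its children.\<close>

fun tailcf :: "nat list \<Rightarrow> real \<Rightarrow> real" where
  "tailcf [] t = t"
| "tailcf (d # w) t = 1 / (real d + tailcf w t)"

lemma tailcf_append: "tailcf (u @ w) t = tailcf u (tailcf w t)"
  by (induction u) auto

lemma tailcf_bounds:
  assumes "\<forall>d\<in>set w. 1 \<le> d" "0 \<le> t" "t \<le> 1"
  shows "0 \<le> tailcf w t \<and> tailcf w t \<le> 1"
  using assms
proof (induction w)
  case (Cons d w)
  then have "0 \<le> tailcf w t" "1 \<le> real d" by auto
  then show ?case by (simp add: divide_simps)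
qed auto

text \<open>A single digit 1 contracts by a factor arbitrarily close to 1 for tails near 0. Two
  digits contract by at least 4, since both denominators \<open>d * (e + x) + 1\<close> are at least
  2; hence the induction in steps of two.\<close>

lemma tailcf_close:
  assumes "\<forall>d\<in>set w. 1 \<le> d" "0 \<le> s" "s \<le> 1" "0 \<le> t" "t \<le> 1"
  shows "\<bar>tailcf w s - tailcf w t\<bar> \<le> 2 * (1/2) ^ length w"
  using assms
proof (induction w rule: induct_list012)
  case (2 d)
  have "1 \<le> real d" using 2 by auto
  then have "0 \<le> 1 / (real d + s)" "1 / (real d + s) \<le> 1" "0 \<le> 1 / (real d + t)" "1 / (real d + t) \<le> 1"
    using 2 by (auto simp: divide_simps)
  then have "\<bar>1 / (real d + s) - 1 / (real d + t)\<bar> \<le> 1" by linarith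
  then show ?case by simp
next
  case (3 d e w)
  define x y where "x = tailcf w s" and "y = tailcf w t"
  have IH: "\<bar>x - y\<bar> \<le> 2 * (1/2) ^ length w" using 3 by (simp add: x_def y_def)
  have b: "0 \<le> x" "0 \<le> y" using tailcf_bounds[of w s] tailcf_bounds[of w t] 3 by (auto simp: x_def y_def)
  have de: "1 \<le> real d" "1 \<le> real e" using 3 by auto
  have ge: "1 \<le> real d * (real e + z)" if "0 \<le> z" for z
    using mult_mono[of 1 "real d" 1 "real e + z"] de that by simp
  have form: "1 / (real d + 1 / (real e + z)) = (real e + z) / (real d * (real e + z) + 1)" if "0 \<le> z" for z
    using de that by (simp add: field_simps)
  have "1 / (real d + 1 / (real e + x)) - 1 / (real d + 1 / (real e + y))
      = (x - y) / ((real d * (real e + x) + 1) * (real d * (real e + y) + 1))"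
  proof -
    have "real d * (real e + x) + 1 \<noteq> 0" "real d * (real e + y) + 1 \<noteq> 0" using ge[OF b(1)] ge[OF b(2)] by auto
    then show ?thesis unfolding form[OF b(1)] form[OF b(2)]
      by (simp add: diff_frac_eq) (simp add: algebra_simps)
  qed
  moreover have "4 \<le> (real d * (real e + x) + 1) * (real d * (real e + y) + 1)"
    using mult_mono[of 2 "real d * (real e + x) + 1" 2 "real d * (real e + y) + 1"] ge[OF b(1)] ge[OF b(2)] by simp
  ultimately have "\<bar>1 / (real d + 1 / (real e + x)) - 1 / (real d + 1 / (real e + y))\<bar>
      = \<bar>x - y\<bar> / ((real d * (real e + x) + 1) * (real d * (real e + y) + 1))"
    by (simp add: abs_divide)
  also have "\<dots> \<le> (2 * (1/2) ^ length w) / 4"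
    using IH \<open>4 \<le> _\<close> by (intro frac_le) simp_all
  finally show ?case by (simp add: x_def y_def)
qed auto

lemma cf_Cons_eq_tailcf:
  "cf (map (\<lambda>d. real_of_int (int d)) (d # w)) = real d + tailcf w 0"
proof (induction w arbitrary: d)
  case (Cons e w)
  show ?case using Cons[of e] by simp
qed simp

section \<open>The outer bound\<close>

text \<open>\<open>overlap\<close> is the transition function of the automaton that recognises \<open>41414\<close>: its state
  \<open>s < 5\<close> is the length of the longest suffix of the word read so far that is a prefix of
  \<open>41414\<close>.\<close>

fun overlap :: "nat \<Rightarrow> nat \<Rightarrow> nat" where
  "overlap s d = (if d = 4 then (if s = 2 then 3 else 1)
     else if d = 1 then (if s = 1 then 2 else if s = 3 then 4 else 0) else 0)"

abbreviation context_word :: "nat \<Rightarrow> nat list" where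
  "context_word s \<equiv> take s [4,1,4,1]"

definition sqrt_disc :: real where "sqrt_disc = sqrt 26565"

text \<open>The least and the largest value \<open>[0; d\<^sub>1, d\<^sub>2, \<dots>]\<close> with digits at most 4 that avoids \<open>41414\<close>
  when read from state \<open>s\<close>. The extremal expansions are the rotations of the period
  \<open>1, 4, 1, 4, 1, 3\<close>, hence the field \<open>\<rat>(\<surd>26565)\<close>.\<close>

definition hull_min :: "nat \<Rightarrow> real" where
  "hull_min s = (if s = 2 then (sqrt_disc - 115) / 230 else if s = 4 then (sqrt_disc - 105) / 222 else (sqrt_disc - 117) / 222)"

definition hull_max :: "nat \<Rightarrow> real" where
  "hull_max s = (if s = 1 then (sqrt_disc - 115) / 58 else if s = 3 then (sqrt_disc - 117) / 58 else (sqrt_disc - 105) / 70)"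

lemma sqrt_disc_bounds: "162.9 < sqrt_disc" "sqrt_disc < 163" and sqrt_disc_sq: "sqrt_disc * sqrt_disc = 26565"
  unfolding sqrt_disc_def by (rule real_less_rsqrt, simp add: power2_eq_square)
    (rule real_less_lsqrt, simp_all add: power2_eq_square)

lemma overlap_less: "s < 5 \<Longrightarrow> overlap s d < 5" by simp

lemma hull_bounds:
  assumes "s < 5"
  shows "0 < hull_min s" "hull_min s \<le> 1/2" "1/2 \<le> hull_max s"
  using sqrt_disc_bounds by (auto simp: hull_min_def hull_max_def field_simps)

text \<open>Since \<open>1 / (d + x)\<close> decreases in \<open>x\<close>, only the end points of
  the hulls matter. The digit 4 stays allowed after a 4, because peaks may contain
  \<open>44\<close>.\<close>

lemma hull_step:
  assumes "s < 5" "1 \<le> d" "d \<le> 4" "\<not> (s = 4 \<and> d = 4)"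
    and "hull_min (overlap s d) \<le> x" "x \<le> hull_max (overlap s d)"
  shows "hull_min s \<le> 1 / (real d + x)" "1 / (real d + x) \<le> hull_max s"
proof -
  have x: "0 < x" using hull_bounds(1)[OF overlap_less[OF assms(1), of d]] assms(5) by linarith
  have s: "s \<in> {0,1,2,3,4}" and d: "d \<in> {1,2,3,4}" using assms by auto
  have m: "0 < hull_min s" using hull_bounds(1)[OF assms(1)] .
  have M: "0 < hull_max s" using hull_bounds(3)[OF assms(1)] by linarith
  have 1: "hull_min s * (real d + hull_max (overlap s d)) \<le> 1"
    using s d assms(4) sqrt_disc_bounds sqrt_disc_sq
    by (auto simp: hull_min_def hull_max_def field_simps)
  have 2: "1 \<le> hull_max s * (real d + hull_min (overlap s d))"
    using s d assms(4) sqrt_disc_bounds sqrt_disc_sq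
    by (auto simp: hull_min_def hull_max_def field_simps)
  have "hull_min s * (real d + x) \<le> hull_min s * (real d + hull_max (overlap s d))"
    using m assms(6) by (intro mult_left_mono) auto
  then show "hull_min s \<le> 1 / (real d + x)" using 1 x by (simp add: field_simps)
  have "hull_max s * (real d + hull_min (overlap s d)) \<le> hull_max s * (real d + x)"
    using M assms(5) by (intro mult_left_mono) auto
  then show "1 / (real d + x) \<le> hull_max s" using 2 x by (simp add: field_simps)
qed

text \<open>The state remembers only digits that were really read, so an occurrence of
  \<open>41414\<close> that starts in the remembered context is a genuine one.\<close>

lemma suffix_context_word:
  assumes "s < 5" "1 \<le> d" "d \<le> 4" "\<not> (s = 4 \<and> d = 4)"
  shows "suffix (context_word (overlap s d)) (context_word s @ [d])"
proof -
  have s: "s \<in> {0,1,2,3,4}" and d: "d \<in> {1,2,3,4}" using assms by auto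
  then show ?thesis using assms(4) by (auto simp: suffix_def)
qed

text \<open>The remainder 1/2 lies in the hull of every state, which settles the empty word;
  \<open>tailcf_close\<close> later exchanges it for any other remainder.\<close>

lemma tailcf_hull:
  assumes "s < 5" "\<forall>d\<in>set w. 1 \<le> d \<and> d \<le> 4" "\<not> sublist [4,1,4,1,4] (context_word s @ w)"
  shows "hull_min s \<le> tailcf w (1/2) \<and> tailcf w (1/2) \<le> hull_max s"
  using assms
proof (induction w arbitrary: s)
  case Nil
  then show ?case using hull_bounds by simp
next
  case (Cons d w)
  have d: "1 \<le> d" "d \<le> 4" using Cons.prems by auto
  have nd: "\<not> (s = 4 \<and> d = 4)" using Cons.prems(3) by (auto simp: sublist_Cons_right)
  obtain us where us: "context_word s @ [d] = us @ context_word (overlap s d)"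
    using suffix_context_word[OF Cons.prems(1) d nd] by (auto simp: suffix_def)
  have "context_word s @ d # w = us @ (context_word (overlap s d) @ w)"
    using us by (metis append.assoc append_Cons append_Nil)
  then have "\<not> sublist [4,1,4,1,4] (context_word (overlap s d) @ w)"
    using Cons.prems(3) sublist_append by metis
  then have "hull_min (overlap s d) \<le> tailcf w (1/2) \<and> tailcf w (1/2) \<le> hull_max (overlap s d)"
    using Cons.IH[OF overlap_less[OF Cons.prems(1)]] Cons.prems(2) by auto
  then show ?case using hull_step[OF Cons.prems(1) d nd] by auto
qed

lemma tailcf_le_hull_max:
  assumes "s < 5" "\<forall>d\<in>set w. 1 \<le> d \<and> d \<le> 4" "\<not> sublist [4,1,4,1,4] (context_word s @ w)"
    and "0 \<le> t" "t \<le> 1"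
  shows "tailcf w t \<le> hull_max s + 2 * (1/2) ^ length w"
  using tailcf_hull[OF assms(1-3)] tailcf_close[of w t "1/2"] assms by auto

lemma hull_max_product: "(4 + hull_max 1) * (3 + hull_max 0) = (19425 + 111 * sqrt 26565) / 2030"
  using sqrt_disc_sq by (simp add: hull_max_def sqrt_disc_def[symmetric] field_simps)


section \<open>Cylinders and gaps of the Cantor set\<close>

text \<open>In the states 1 and 3 the last digit is 4 and in state 4 the last digits are \<open>4141\<close>, so another
  4 would complete \<open>44\<close> or \<open>41414\<close>.\<close>

definition max_digit :: "nat \<Rightarrow> nat" where
  "max_digit s = (if s = 0 \<or> s = 2 then 4 else 3)"

text \<open>Rational inner approximations of the end points of the Cantor set: rounding inwards keeps every
  interval covered by its two pieces and the gap between them.\<close>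

definition core_min :: "nat \<Rightarrow> real" where
  "core_min s = (if s = 0 then 2072 / 10000 else if s = 2 then 2087 / 10000 else 2613 / 10000)"

definition core_max :: "nat \<Rightarrow> real" where
  "core_max s = 1 / (1 + core_min (overlap s 1))"

text \<open>The map \<open>t \<mapsto> 1 / (d + t)\<close> reverses order: the piece of digit
  \<open>i + 1\<close> ends where its tail is least, and the piece of digit \<open>i\<close> begins
  where its tail is largest.\<close>

definition gap_left :: "nat \<Rightarrow> nat \<Rightarrow> real" where
  "gap_left s i = 1 / (real i + 1 + core_min (overlap s (i + 1)))"

definition gap_right :: "nat \<Rightarrow> nat \<Rightarrow> real" where
  "gap_right s i = 1 / (real i + core_max (overlap s i))"

definition node_right :: "nat \<Rightarrow> nat \<Rightarrow> real" where
  "node_right s i = 1 / (real i + core_min (overlap s i))"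



lemma core_max_simps:
  "core_max 0 = 1250 / 1509" "core_max 1 = 10000 / 12087" "core_max 2 = 1250 / 1509" "core_max 3 = 10000 / 12613" "core_max 4 = 1250 / 1509"
  by (simp_all add: core_max_def core_min_def)

lemma gap_left_simps:
  "gap_left 0 1 = 1250 / 2759" "gap_left 0 2 = 1250 / 4009" "gap_left 0 3 = 10000 / 42613"
  "gap_left 1 1 = 1250 / 2759" "gap_left 1 2 = 1250 / 4009" "gap_left 2 1 = 1250 / 2759"
  "gap_left 2 2 = 1250 / 4009" "gap_left 2 3 = 10000 / 42613" "gap_left 3 1 = 1250 / 2759"
  "gap_left 3 2 = 1250 / 4009" "gap_left 4 1 = 1250 / 2759" "gap_left 4 2 = 1250 / 4009"
  by (simp_all del: One_nat_def add: gap_left_def core_min_def)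

lemma gap_right_simps:
  "gap_right 0 1 = 1509 / 2759" "gap_right 0 2 = 1509 / 4268" "gap_right 0 3 = 1509 / 5777"
  "gap_right 1 1 = 1509 / 2759" "gap_right 1 2 = 1509 / 4268" "gap_right 2 1 = 1509 / 2759"
  "gap_right 2 2 = 1509 / 4268" "gap_right 2 3 = 1509 / 5777" "gap_right 3 1 = 1509 / 2759"
  "gap_right 3 2 = 1509 / 4268" "gap_right 4 1 = 1509 / 2759" "gap_right 4 2 = 1509 / 4268"
  by (simp_all del: One_nat_def add: gap_right_def core_max_simps core_min_def)

lemma node_right_simps:
  "node_right 0 1 = 1250 / 1509" "node_right 0 2 = 1250 / 2759" "node_right 0 3 = 1250 / 4009"
  "node_right 1 1 = 10000 / 12087" "node_right 1 2 = 1250 / 2759" "node_right 2 1 = 1250 / 1509"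
  "node_right 2 2 = 1250 / 2759" "node_right 2 3 = 1250 / 4009" "node_right 3 1 = 10000 / 12613"
  "node_right 3 2 = 1250 / 2759" "node_right 4 1 = 1250 / 1509" "node_right 4 2 = 1250 / 2759"
  by (simp_all del: One_nat_def add: node_right_def core_min_def)

lemmas node_simps = core_min_def core_max_simps gap_left_simps gap_right_simps node_right_simps

lemma node_cases:
  assumes "s < 5" "1 \<le> i" "i < max_digit s"
  shows "(s, i) \<in> {(0,1),(0,2),(0,3),(1,1),(1,2),(2,1),(2,2),(2,3),(3,1),(3,2),(4,1),(4,2)}"
proof -
  have "s = 0 \<or> s = 1 \<or> s = 2 \<or> s = 3 \<or> s = 4" using assms(1) by linarith
  moreover have "i = 1 \<or> i = 2 \<or> i = 3 \<and> (s = 0 \<or> s = 2)"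
    using assms(2,3) unfolding max_digit_def by (cases "s = 0 \<or> s = 2") (simp_all, linarith+)
  ultimately show ?thesis by (elim disjE conjE) simp_all
qed

lemma core_min_bounds: "1/5 < core_min s" "core_min s < 3/10"
  by (auto simp: core_min_def)

lemma node_order:
  assumes "s < 5" "1 \<le> i" "i < max_digit s"
  shows "core_min s < gap_left s i" "gap_left s i < gap_right s i" "gap_right s i < node_right s i"
    "node_right s i \<le> 1"
  using node_cases[OF assms] by (auto simp del: One_nat_def simp: node_simps)

text \<open>Only the node of state 2 that splits digit 4 from digit 3 violates \<open>gap \<le> left piece\<close> in the
  coordinate \<open>t\<close>; there the curvature of the Moebius map makes up for it.\<close>

lemma node_left_piece:
  assumes "s < 5" "1 \<le> i" "i < max_digit s"
  defines "l \<equiv> gap_left s i - core_min s" and "g \<equiv> gap_right s i - gap_left s i"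
  shows "s \<noteq> 2 \<Longrightarrow> g \<le> l" "(g - l) * (5/4 + gap_left s i) \<le> 2 * g * l"
  using node_cases[OF assms(1-3)] by (auto simp del: One_nat_def simp: node_simps l_def g_def)

text \<open>On this side concavity works against the claim. For \<open>p' \<le> p\<close> and
  \<open>q' \<le> q\<close> the curvature term \<open>p' / (p + p' * t) + q' / (q + q' * t)\<close>
  is at most \<open>2 / (1 + t)\<close>, and the right piece has to exceed the gap
  accordingly.\<close>

lemma node_right_piece:
  assumes "s < 5" "1 \<le> i" "i < max_digit s"
  defines "r \<equiv> node_right s i - gap_right s i" and "g \<equiv> gap_right s i - gap_left s i"
  shows "2 * g * r \<le> (r - g) * (1 + gap_right s i)"
  using node_cases[OF assms(1-3)] by (auto simp del: One_nat_def simp: node_simps r_def g_def)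

text \<open>A sufficient condition, valid for all maps with \<open>p' \<le> p\<close> and
  \<open>q' \<le> q\<close>, for the gap of the node to be the longer one in logarithmic length:
  between \<open>u\<close> and \<open>gap_right s i\<close> numerator and denominator each grow at
  most like \<open>1 + t\<close>.\<close>

definition gap_dominates :: "nat \<Rightarrow> nat \<Rightarrow> real \<Rightarrow> real \<Rightarrow> bool" where
  "gap_dominates s i u v \<longleftrightarrow> 0 \<le> u \<and> u < v \<and> v - u \<le> gap_right s i - gap_left s i \<and>
     (v - u) * (1 + gap_right s i)^2 \<le> (gap_right s i - gap_left s i) * (1 + u)^2"

text \<open>Digit 2 always leads to state 0. Digit 1 leads to state 0, 2 or 4, and these share one
  \<open>core_max\<close>, as a further 1 leads from each of them to state 0.\<close>

lemma gap_first:
  assumes "s < 5"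
  shows "gap_left s 1 = 1250 / 2759" "gap_right s 1 = 1509 / 2759"
proof -
  have "s = 0 \<or> s = 1 \<or> s = 2 \<or> s = 3 \<or> s = 4" using assms by linarith
  then show "gap_left s 1 = 1250 / 2759" "gap_right s 1 = 1509 / 2759"
    by (elim disjE; simp only: node_simps)+
qed

text \<open>The first gap of the child with digit \<open>i\<close>, pulled back to the coordinate of
  the parent; the order reversal swaps its ends. The next two lemmas treat the other child,
  according to whether it still contains several digits or only the largest one.\<close>

lemma gap_dominates_cylinder:
  assumes "s < 5" "1 \<le> i" "i < max_digit s"
  shows "gap_dominates s i (1 / (real i + gap_right (overlap s i) 1)) (1 / (real i + gap_left (overlap s i) 1))"
  unfolding gap_first[OF overlap_less[OF assms(1)]]
  using node_cases[OF assms] by (auto simp del: One_nat_def simp: gap_dominates_def node_simps power2_eq_square)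

lemma gap_dominates_next:
  assumes "s < 5" "1 \<le> i" "i + 1 < max_digit s"
  shows "gap_dominates s i (gap_left s (i + 1)) (gap_right s (i + 1))"
proof -
  have "i < max_digit s" using assms by simp
  from node_cases[OF assms(1,2) this] show ?thesis
    using assms(3) by (auto simp del: One_nat_def simp: max_digit_def gap_dominates_def node_simps power2_eq_square)
qed

lemma gap_dominates_last:
  assumes "s < 5" "1 \<le> i" "i + 1 = max_digit s"
  defines "j \<equiv> i + 1"
  shows "gap_dominates s i (1 / (real j + gap_right (overlap s j) 1)) (1 / (real j + gap_left (overlap s j) 1))"
proof -
  have "i < max_digit s" using assms by simp
  from node_cases[OF assms(1,2) this] show ?thesis
    using assms(3) by (auto simp del: One_nat_def simp: j_def max_digit_def gap_dominates_def node_simps power2_eq_square)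
qed

text \<open>Rounding \<open>core_min\<close> upwards turns the equation for the least element into
  an inequality: the cylinder of the largest digit reaches at least to the end of its
  parent.\<close>

lemma core_min_cover:
  assumes "s < 5"
  shows "1 / (real (max_digit s) + core_max (overlap s (max_digit s))) \<le> core_min s"
proof -
  have "s \<in> {0,1,2,3,4}" using assms by auto
  then show ?thesis by (auto simp del: One_nat_def simp: node_simps max_digit_def)
qed


section \<open>Logarithms of Moebius maps around a gap\<close>

definition moebius :: "real \<Rightarrow> real \<Rightarrow> real \<Rightarrow> real \<Rightarrow> real \<Rightarrow> real" where
  "moebius p p' q q' t = (p + p' * t) / (q + q' * t)"

text \<open>Here \<open>h\<close> is an increasing coordinate; a decreasing one enters through its
  negative. The third clause is what makes gaps shrink from a node to its children.\<close>

definition split_conditions :: "(real \<Rightarrow> real) \<Rightarrow> nat \<Rightarrow> nat \<Rightarrow> bool" where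
  "split_conditions h s i \<longleftrightarrow>
     h (gap_right s i) - h (gap_left s i) \<le> h (gap_left s i) - h (core_min s) \<and>
     h (gap_right s i) - h (gap_left s i) \<le> h (node_right s i) - h (gap_right s i) \<and>
     (\<forall>u v. gap_dominates s i u v \<longrightarrow> h v - h u \<le> h (gap_right s i) - h (gap_left s i)) \<and>
     (\<forall>u v. 0 \<le> u \<longrightarrow> u < v \<longrightarrow> h u < h v)"

lemma moebius_pos:
  assumes "0 < p" "0 \<le> p'" "0 < q" "0 \<le> q'" "0 \<le> t"
  shows "0 < p + p' * t" "0 < q + q' * t" "0 < moebius p p' q q' t"
proof -
  show 1: "0 < p + p' * t" using assms by (intro add_pos_nonneg) auto
  show 2: "0 < q + q' * t" using assms by (intro add_pos_nonneg) auto
  show "0 < moebius p p' q q' t" using 1 2 by (simp add: moebius_def)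
qed

text \<open>After exponentiating and clearing denominators, the difference of the two sides has the
  determinant \<open>p' * q - p * q'\<close> as a factor. With \<open>t - l\<close>,
  \<open>t\<close>, \<open>t + g\<close> as consecutive end points this decides whether a gap of
  length \<open>g\<close> is at most the piece of length \<open>l\<close> in logarithmic
  length.\<close>

lemma moebius_log_concave_iff:
  fixes t g l :: real
  assumes pos: "0 < p" "0 \<le> p'" "0 < q" "0 \<le> q'" and "0 \<le> t - l" "0 \<le> l" "0 \<le> g"
  shows "ln (moebius p p' q q' (t + g)) + ln (moebius p p' q q' (t - l)) \<le> 2 * ln (moebius p p' q q' t) \<longleftrightarrow>
    0 \<le> (p' * q - p * q') * ((l - g) * (p + p' * t) * (q + q' * t) + g * l * (p * q' + p' * q + 2 * p' * q' * t))"
proof -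
  define a b where "a = p + p' * t" and "b = q + q' * t"
  have t: "0 \<le> t" "0 \<le> t + g" using assms by auto
  have p1: "p + p' * (t + g) = a + p' * g" "q + q' * (t + g) = b + q' * g"
    and p2: "p + p' * (t - l) = a - p' * l" "q + q' * (t - l) = b - q' * l"
    by (simp_all add: a_def b_def algebra_simps)
  have ps: "0 < a + p' * g" "0 < b + q' * g" "0 < a - p' * l" "0 < b - q' * l" "0 < a" "0 < b"
    using moebius_pos(1,2)[OF pos t(2)] moebius_pos(1,2)[OF pos assms(5)] moebius_pos(1,2)[OF pos t(1)]
    unfolding p1 p2 by (simp_all add: a_def b_def)
  have "ln (moebius p p' q q' (t + g)) + ln (moebius p p' q q' (t - l)) \<le> 2 * ln (moebius p p' q q' t) \<longleftrightarrow>
    ln (moebius p p' q q' (t + g) * moebius p p' q q' (t - l)) \<le> ln (moebius p p' q q' t ^ 2)"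
    using moebius_pos(3)[OF pos t(2)] moebius_pos(3)[OF pos assms(5)] moebius_pos(3)[OF pos t(1)]
    by (simp add: ln_mult ln_realpow)
  also have "\<dots> \<longleftrightarrow> moebius p p' q q' (t + g) * moebius p p' q q' (t - l) \<le> moebius p p' q q' t ^ 2"
    using moebius_pos(3)[OF pos t(2)] moebius_pos(3)[OF pos assms(5)] moebius_pos(3)[OF pos t(1)]
    by (subst ln_le_cancel_iff) auto
  also have "\<dots> \<longleftrightarrow> (a + p' * g) * (a - p' * l) * b^2 \<le> a^2 * ((b + q' * g) * (b - q' * l))"
    using ps unfolding moebius_def p1 p2 a_def[symmetric] b_def[symmetric]
    by (simp add: divide_simps power2_eq_square)
  also have "\<dots> \<longleftrightarrow> 0 \<le> (p' * b - a * q') * ((l - g) * a * b + g * l * (a * q' + p' * b))"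
  proof -
    have "a^2 * ((b + q' * g) * (b - q' * l)) - (a + p' * g) * (a - p' * l) * b^2
      = (p' * b - a * q') * ((l - g) * a * b + g * l * (a * q' + p' * b))"
      by algebra
    then show ?thesis by linarith
  qed
  finally show ?thesis unfolding a_def b_def by (simp add: algebra_simps)
qed

lemma ln_moebius_swap:
  assumes "0 < p" "0 \<le> p'" "0 < q" "0 \<le> q'" "0 \<le> t"
  shows "ln (moebius q q' p p' t) = - ln (moebius p p' q q' t)"
  using moebius_pos[OF assms] by (simp add: moebius_def ln_div)

text \<open>Orientation \<open>p' q - p q' > 0\<close>; the other one is reduced to it by passing to the reciprocal.\<close>

lemma split_conditions_moebius:
  assumes node: "s < 5" "1 \<le> i" "i < max_digit s"
    and pos: "0 < p" "0 \<le> p'" "0 < q" "0 \<le> q'" and det: "0 < p' * q - p * q'"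
    and le: "p' \<le> p" "q' \<le> q" and s2: "s = 2 \<longrightarrow> 4 * p \<le> 5 * p' \<and> 4 * q \<le> 5 * q'"
  shows "split_conditions (\<lambda>t. ln (moebius p p' q q' t)) s i"
proof -
  define h where "h t = ln (moebius p p' q q' t)" for t
  define t0 t1 t2 t3 where "t0 = core_min s" and "t1 = gap_left s i" and "t2 = gap_right s i" and "t3 = node_right s i"
  note tdefs = t0_def t1_def t2_def t3_def
  have ord: "0 < t0" "t0 < t1" "t1 < t2" "t2 < t3"
    using node_order[OF node] core_min_bounds[of s] by (auto simp: tdefs)
  define l g r where "l = t1 - t0" and "g = t2 - t1" and "r = t3 - t2"
  have lgr: "0 < l" "0 < g" "0 < r" using ord by (auto simp: l_def g_def r_def)
  have mono: "h u < h v" if "0 \<le> u" "u < v" for u v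
  proof -
    have v: "0 \<le> v" using that by simp
    have "(p' * q - p * q') * u < (p' * q - p * q') * v" using det that by (intro mult_strict_left_mono) auto
    then have "(p + p' * u) * (q + q' * v) < (p + p' * v) * (q + q' * u)" by (simp add: algebra_simps)
    then have "moebius p p' q q' u < moebius p p' q q' v"
      using moebius_pos(2)[OF pos that(1)] moebius_pos(2)[OF pos v] by (simp add: moebius_def divide_simps)
    then show ?thesis
      using moebius_pos(3)[OF pos that(1)] moebius_pos(3)[OF pos v] by (simp add: h_def)
  qed
  have left: "h t2 - h t1 \<le> h t1 - h t0"
  proof -
    define a b where "a = p + p' * t1" and "b = q + q' * t1"
    have ab: "0 < a" "0 < b" using moebius_pos(1,2)[OF pos, of t1] ord by (auto simp: a_def b_def)
    have "0 \<le> (l - g) * a * b + g * l * (p * q' + p' * q + 2 * p' * q' * t1)"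
    proof (cases "g \<le> l")
      case True
      have "0 \<le> p * q' + p' * q + 2 * p' * q' * t1" using pos ord by (intro add_nonneg_nonneg mult_nonneg_nonneg) auto
      then have "0 \<le> g * l * (p * q' + p' * q + 2 * p' * q' * t1)" using lgr by (intro mult_nonneg_nonneg) auto
      moreover have "0 \<le> (l - g) * a * b" using True ab by (intro mult_nonneg_nonneg) auto
      ultimately show ?thesis by linarith
    next
      case False
      then have "s = 2" using node_left_piece(1)[OF node] by (auto simp: g_def l_def tdefs)
      then have c: "4 * p \<le> 5 * p'" "4 * q \<le> 5 * q'" using s2 by auto
      \<comment> \<open>Both \<open>a / p'\<close> and \<open>b / q'\<close> are at most
        \<open>w\<close>, so the curvature contributes at least \<open>2 * g * l / w\<close>, which
        outweighs the excess \<open>g - l\<close>.\<close>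
      define w where "w = 5/4 + t1"
      have w: "0 < w" using ord by (simp add: w_def)
      have "a \<le> w * p'" "b \<le> w * q'" using c by (auto simp: a_def b_def w_def algebra_simps)
      then have "a * b \<le> w * p' * b" "a * b \<le> w * q' * a"
        using ab by (auto intro: mult_right_mono simp: mult.commute mult.left_commute mult.assoc)
      then have "2 * (a * b) \<le> w * (p' * b + q' * a)" by (simp add: algebra_simps)
      then have Y: "(2 * g * l) * (2 * (a * b)) \<le> (2 * g * l) * (w * (p' * b + q' * a))"
        using lgr by (intro mult_left_mono) auto
      have "(g - l) * w \<le> 2 * g * l"
        using node_left_piece(2)[OF node] by (simp add: g_def l_def w_def tdefs)
      then have "((g - l) * w) * (2 * (a * b)) \<le> (2 * g * l) * (2 * (a * b))"
        using ab by (intro mult_right_mono) auto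
      also note Y
      also have "(2 * g * l) * (w * (p' * b + q' * a)) = w * (2 * (g * l * (p' * b + q' * a)))"
        by (simp add: algebra_simps)
      also have "((g - l) * w) * (2 * (a * b)) = w * (2 * ((g - l) * a * b))"
        by (simp add: algebra_simps)
      finally have "w * (2 * ((g - l) * a * b)) \<le> w * (2 * (g * l * (p' * b + q' * a)))" .
      then have "(g - l) * a * b \<le> g * l * (p' * b + q' * a)" using w by simp
      then have "0 \<le> - ((g - l) * a * b) + g * l * (p' * b + q' * a)" by simp
      moreover have "p * q' + p' * q + 2 * p' * q' * t1 = p' * b + q' * a" by (simp add: a_def b_def algebra_simps)
      moreover have "(l - g) * a * b = - ((g - l) * a * b)" by (simp add: algebra_simps)
      ultimately show ?thesis by (simp only:)
    qed
    then have "0 \<le> (p' * q - p * q') * ((l - g) * (p + p' * t1) * (q + q' * t1) + g * l * (p * q' + p' * q + 2 * p' * q' * t1))"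
      using det by (intro mult_nonneg_nonneg) (auto simp: a_def b_def)
    then have "h (t1 + g) + h (t1 - l) \<le> 2 * h t1"
      unfolding h_def using moebius_log_concave_iff[OF pos, of t1 l g] ord lgr by (simp add: l_def)
    then show ?thesis by (simp add: g_def l_def)
  qed
  have right: "h t2 - h t1 \<le> h t3 - h t2"
  proof -
    define a b where "a = p + p' * t2" and "b = q + q' * t2"
    have ab: "0 < a" "0 < b" using moebius_pos(1,2)[OF pos, of t2] ord by (auto simp: a_def b_def)
    define w where "w = 1 + t2"
    have w: "0 < w" using ord by (simp add: w_def)
    have "w * p' \<le> a" "w * q' \<le> b" using le by (auto simp: a_def b_def w_def algebra_simps)
    then have "w * p' * b \<le> a * b" "w * q' * a \<le> a * b"
      using ab by (auto intro: mult_right_mono simp: mult.commute mult.left_commute mult.assoc)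
    then have c: "w * (p' * b + q' * a) \<le> 2 * (a * b)" by (simp add: algebra_simps)
    have num: "2 * g * r \<le> (r - g) * w"
      using node_right_piece[OF node] by (simp add: g_def r_def w_def tdefs)
    have "w * (2 * (g * r * (p' * b + q' * a))) = (2 * g * r) * (w * (p' * b + q' * a))"
      by (simp add: algebra_simps)
    also have "\<dots> \<le> (2 * g * r) * (2 * (a * b))"
      using c lgr by (intro mult_left_mono) auto
    also have "\<dots> \<le> ((r - g) * w) * (2 * (a * b))"
      using num ab by (intro mult_right_mono) auto
    also have "\<dots> = w * (2 * ((r - g) * a * b))"
      by (simp add: algebra_simps)
    finally have "w * (2 * (g * r * (p' * b + q' * a))) \<le> w * (2 * ((r - g) * a * b))" .
    then have "g * r * (p' * b + q' * a) \<le> (r - g) * a * b" using w by simp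
    then have "- ((r - g) * a * b) + g * r * (p' * b + q' * a) \<le> 0" by simp
    moreover have "p * q' + p' * q + 2 * p' * q' * t2 = p' * b + q' * a" by (simp add: a_def b_def algebra_simps)
    moreover have "(g - r) * a * b = - ((r - g) * a * b)" "r * g = g * r" by (simp_all add: algebra_simps)
    ultimately have neg: "(g - r) * a * b + r * g * (p * q' + p' * q + 2 * p' * q' * t2) \<le> 0"
      by (simp only:)
    \<comment> \<open>The reversed inequality comes from the same criterion for the reciprocal map,
      whose logarithm is the negative; \<open>g\<close> now plays the part of the left piece and
      \<open>r\<close> that of the gap.\<close>
    have "0 \<le> (q' * p - q * p') * ((g - r) * (q + q' * t2) * (p + p' * t2) + r * g * (q * p' + q' * p + 2 * q' * p' * t2))"
    proof (rule mult_nonpos_nonpos)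
      show "q' * p - q * p' \<le> 0" using det by (simp add: mult.commute)
      show "(g - r) * (q + q' * t2) * (p + p' * t2) + r * g * (q * p' + q' * p + 2 * q' * p' * t2) \<le> 0"
        using neg by (simp add: a_def b_def mult_ac add_ac)
    qed
    then have "ln (moebius q q' p p' (t2 + r)) + ln (moebius q q' p p' (t2 - g)) \<le> 2 * ln (moebius q q' p p' t2)"
      using moebius_log_concave_iff[OF pos(3,4,1,2), of t2 g r] ord lgr by (simp add: g_def)
    then have "2 * h t2 \<le> h (t2 + r) + h (t2 - g)"
      using ord lgr ln_moebius_swap[OF pos] by (simp add: h_def g_def)
    then show ?thesis by (simp add: g_def r_def)
  qed
  have dom: "h v - h u \<le> h t2 - h t1" if dd: "gap_dominates s i u v" for u v
  proof -
    have u: "0 \<le> u" "u < v" "v - u \<le> g" "(v - u) * (1 + t2)^2 \<le> g * (1 + u)^2"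
      using dd by (auto simp: gap_dominates_def g_def tdefs)
    define A B where "A t = p + p' * t" and "B t = q + q' * t" for t
    have AB: "0 < A t" "0 < B t" if "0 \<le> t" for t
      using moebius_pos(1,2)[OF pos that] by (auto simp: A_def B_def)
    have ABmono: "A x \<le> A y" "B x \<le> B y" if "x \<le> y" for x y
      using pos that by (auto simp: A_def B_def intro: mult_left_mono)
    have t: "0 \<le> t1" "0 \<le> t2" "0 \<le> v" using ord u by auto
    \<comment> \<open>The logarithmic length of an interval from \<open>x\<close> to
      \<open>y\<close> is \<open>ln (1 + D * (y - x) / (A x * B y))\<close> with determinant
      \<open>D\<close>, so this inequality is the whole comparison.\<close>
    have key: "(v - u) * (A t1 * B t2) \<le> g * (A u * B v)"
    proof (cases "u \<le> t2")
      case True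
      have "p' * (t2 - u) \<le> p * (t2 - u)" "q' * (t2 - u) \<le> q * (t2 - u)"
        using le True by (auto intro: mult_right_mono)
      then have 1: "A t2 * (1 + u) \<le> A u * (1 + t2)" "B t2 * (1 + u) \<le> B u * (1 + t2)"
        by (auto simp: A_def B_def algebra_simps)
      have "A t1 * (1 + u) \<le> A u * (1 + t2)"
        using 1(1) mult_right_mono[OF ABmono(1), of t1 t2 "1 + u"] ord u by linarith
      moreover have "B t2 * (1 + u) \<le> B v * (1 + t2)"
        using 1(2) mult_right_mono[OF ABmono(2), of u v "1 + t2"] t u by linarith
      ultimately have "(A t1 * (1 + u)) * (B t2 * (1 + u)) \<le> (A u * (1 + t2)) * (B v * (1 + t2))"
        using AB[OF t(2)] AB[OF t(3)] AB[OF u(1)] u t by (intro mult_mono[of "A t1 * (1 + u)" "A u * (1 + t2)"]) auto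
      then have "(v - u) * ((A t1 * (1 + u)) * (B t2 * (1 + u))) \<le> (v - u) * ((A u * (1 + t2)) * (B v * (1 + t2)))"
        using u by (intro mult_left_mono) auto
      also have "\<dots> = ((v - u) * (1 + t2)^2) * (A u * B v)" by (simp add: power2_eq_square)
      also have "\<dots> \<le> (g * (1 + u)^2) * (A u * B v)"
        using u(4) AB[OF u(1)] AB[OF t(3)] by (intro mult_right_mono) auto
      finally have "((v - u) * (A t1 * B t2)) * (1 + u)^2 \<le> (g * (A u * B v)) * (1 + u)^2"
        by (simp add: power2_eq_square mult_ac)
      then show ?thesis using u by (simp add: mult_le_cancel_right)
    next
      case False
      have "A t1 * B t2 \<le> A u * B v"
        using ABmono(1)[of t1 u] ABmono(2)[of t2 v] AB[OF t(2)] AB[OF u(1)] False ord u by (intro mult_mono[of "A t1" "A u"]) auto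
      then show ?thesis
        using u AB[OF t(1)] AB[OF t(2)] lgr by (intro mult_mono[of "v - u" g]) auto
    qed
    have ratio: "A y * B x = A x * B y + (p' * q - p * q') * (y - x)" for x y
      by (simp add: A_def B_def algebra_simps)
    have "(p' * q - p * q') * ((v - u) * (A t1 * B t2)) \<le> (p' * q - p * q') * (g * (A u * B v))"
      using key det by (intro mult_left_mono) auto
    then have "(A v * B u) * (A t1 * B t2) \<le> (A t2 * B t1) * (A u * B v)"
      unfolding ratio[of v u] ratio[of t2 t1] g_def by (simp add: algebra_simps)
    then have "moebius p p' q q' v * moebius p p' q q' t1 \<le> moebius p p' q q' t2 * moebius p p' q q' u"
      unfolding moebius_def A_def[symmetric] B_def[symmetric]
      using AB[OF t(1)] AB[OF t(2)] AB[OF t(3)] AB[OF u(1)] by (simp add: divide_simps mult_ac)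
    then have "ln (moebius p p' q q' v * moebius p p' q q' t1) \<le> ln (moebius p p' q q' t2 * moebius p p' q q' u)"
      using moebius_pos(3)[OF pos t(1)] moebius_pos(3)[OF pos t(2)] moebius_pos(3)[OF pos t(3)] moebius_pos(3)[OF pos u(1)]
      by (subst ln_le_cancel_iff) auto
    then show ?thesis
      using moebius_pos(3)[OF pos t(1)] moebius_pos(3)[OF pos t(2)] moebius_pos(3)[OF pos t(3)] moebius_pos(3)[OF pos u(1)]
      by (simp add: h_def ln_mult)
  qed
  show ?thesis unfolding split_conditions_def
    using left right dom mono by (auto simp: h_def tdefs)
qed


section \<open>The tree of cylinders in logarithmic coordinates\<close>

definition log_val :: "real \<Rightarrow> nat list \<Rightarrow> real \<Rightarrow> real" where
  "log_val a w t = ln (a + tailcf w t)"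

text \<open>The words follow a digit that is at least 4, so the automaton starts in state 1, which represents
  a preceding digit 4.\<close>

definition word_state :: "nat list \<Rightarrow> nat" where
  "word_state w = foldl overlap 1 w"

definition admissible :: "nat list \<Rightarrow> bool" where
  "admissible w \<longleftrightarrow> (\<forall>j<length w. 1 \<le> w ! j \<and> w ! j \<le> max_digit (word_state (take j w)))"

lemma word_state_snoc: "word_state (w @ [d]) = overlap (word_state w) d"
  by (simp add: word_state_def)

lemma word_state_less: "word_state w < 5"
  by (induction w rule: rev_induct) (simp add: word_state_def, simp only: word_state_snoc overlap_less)

lemma admissible_snoc:
  "admissible (w @ [d]) \<longleftrightarrow> admissible w \<and> 1 \<le> d \<and> d \<le> max_digit (word_state w)"
  by (auto simp: admissible_def nth_append less_Suc_eq)

lemma admissible_digits: "admissible w \<Longrightarrow> \<forall>d\<in>set w. 1 \<le> d"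
  by (auto simp: admissible_def in_set_conv_nth)

lemma log_val_snoc: "log_val a (w @ [d]) t = log_val a w (1 / (real d + t))"
  by (simp add: log_val_def tailcf_append)

lemma log_val_close:
  assumes "4 \<le> a" "\<forall>d\<in>set w. 1 \<le> d" "0 \<le> s" "s \<le> 1" "0 \<le> t" "t \<le> 1"
  shows "\<bar>log_val a w s - log_val a w t\<bar> \<le> (1/2) ^ length w"
proof -
  define x y where "x = a + tailcf w s" and "y = a + tailcf w t"
  have xy: "4 \<le> x" "4 \<le> y"
    using tailcf_bounds[OF assms(2)] assms by (auto simp: x_def y_def add_increasing2)
  have ln_le: "ln u - ln v \<le> \<bar>u - v\<bar> / 4" if "4 \<le> u" "4 \<le> v" for u v :: real
  proof -
    have "ln u - ln v \<le> (u - v) / v" using that ln_diff_le[of u v] by auto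
    also have "\<dots> \<le> \<bar>u - v\<bar> / 4" using that by (intro frac_le) auto
    finally show ?thesis .
  qed
  have "\<bar>ln x - ln y\<bar> \<le> \<bar>x - y\<bar> / 4"
    using ln_le[OF xy] ln_le[OF xy(2,1), unfolded abs_minus_commute[of y x]] by (intro abs_leI) simp_all
  also have "\<dots> \<le> (1/2) ^ length w"
    using tailcf_close[OF assms(2-6)] by (simp add: x_def y_def)
  finally show ?thesis by (simp add: log_val_def x_def y_def)
qed

text \<open>The coefficients come from consecutive convergents, hence determinant 1 or -1. A last
  digit 4 makes \<open>p\<close> at least \<open>4 * p'\<close>; for the empty word
  \<open>a \<ge> 4\<close> does this. A following 1 replaces \<open>p / p'\<close> by
  \<open>1 + p' / p\<close>, which is at most 5/4, and likewise for \<open>q\<close>.\<close>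

lemma word_moebius:
  assumes a: "4 \<le> a" and w: "admissible w"
  shows "\<exists>p p' q q'. 0 < p \<and> 0 \<le> p' \<and> 0 < q \<and> 0 \<le> q' \<and> p' \<le> p \<and> q' \<le> q \<and>
    (p' * q - p * q' = 1 \<or> p' * q - p * q' = - 1) \<and>
    (word_state w = 1 \<or> word_state w = 3 \<longrightarrow> 4 * p' \<le> p \<and> 4 * q' \<le> q) \<and>
    (word_state w = 2 \<longrightarrow> 4 * p \<le> 5 * p' \<and> 4 * q \<le> 5 * q') \<and>
    (\<forall>t\<ge>0. a + tailcf w t = moebius p p' q q' t)"
  using w
proof (induction w rule: rev_induct)
  case Nil
  show ?case
    by (rule exI[of _ a], rule exI[of _ 1], rule exI[of _ 1], rule exI[of _ 0])
      (use a in \<open>auto simp: word_state_def moebius_def\<close>)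
next
  case (snoc d w)
  then have d: "1 \<le> d" by (simp add: admissible_snoc)
  obtain p p' q q' where pos: "0 < p" "0 \<le> p'" "0 < q" "0 \<le> q'" and le: "p' \<le> p" "q' \<le> q"
    and det: "p' * q - p * q' = 1 \<or> p' * q - p * q' = - 1"
    and s1: "word_state w = 1 \<or> word_state w = 3 \<longrightarrow> 4 * p' \<le> p \<and> 4 * q' \<le> q"
    and eq: "\<And>t. 0 \<le> t \<Longrightarrow> a + tailcf w t = moebius p p' q q' t"
    using snoc by (auto simp: admissible_snoc)
  have dp: "p \<le> real d * p" "q \<le> real d * q" using d pos by auto
  have "a + tailcf (w @ [d]) t = moebius (real d * p + p') p (real d * q + q') q t" if t: "0 \<le> t" for t
  proof -
    have dt: "0 < real d + t" using d t by linarith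
    then have "a + tailcf (w @ [d]) t = moebius p p' q q' (1 / (real d + t))"
      by (simp add: tailcf_append eq)
    also have "\<dots> = ((p + p' * (1 / (real d + t))) * (real d + t)) / ((q + q' * (1 / (real d + t))) * (real d + t))"
      using dt by (simp add: moebius_def)
    also have "\<dots> = moebius (real d * p + p') p (real d * q + q') q t"
    proof -
      have inv: "(1 / (real d + t)) * (real d + t) = 1" using dt by simp
      have "(x + y * (1 / (real d + t))) * (real d + t) = real d * x + y + x * t" for x y
        unfolding distrib_right mult.assoc inv by (simp add: algebra_simps)
      then show ?thesis by (simp only: moebius_def)
    qed
    finally show ?thesis .
  qed
  moreover have "4 * p \<le> real d * p + p' \<and> 4 * q \<le> real d * q + q'"
    if "word_state (w @ [d]) = 1 \<or> word_state (w @ [d]) = 3"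
  proof -
    have "d = 4" using that by (simp add: word_state_snoc split: if_splits)
    then show ?thesis using pos by simp
  qed
  moreover have "4 * (real d * p + p') \<le> 5 * p \<and> 4 * (real d * q + q') \<le> 5 * q"
    if "word_state (w @ [d]) = 2"
  proof -
    have "d = 1" "word_state w = 1" using that by (simp_all add: word_state_snoc split: if_splits)
    then show ?thesis using s1 by simp
  qed
  moreover have "p * (real d * q + q') - (real d * p + p') * q = 1 \<or> p * (real d * q + q') - (real d * p + p') * q = - 1"
  proof -
    have "p * (real d * q + q') - (real d * p + p') * q = - (p' * q - p * q')" by (simp add: algebra_simps)
    then show ?thesis using det by (metis add.inverse_inverse)
  qed
  moreover have "0 < real d * p + p'" "0 < real d * q + q'" "p \<le> real d * p + p'" "q \<le> real d * q + q'" "0 \<le> p" "0 \<le> q"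
    using pos dp by linarith+
  ultimately show ?case using pos by blast
qed

lemma split_conditions_cong:
  assumes "\<And>t. 0 \<le> t \<Longrightarrow> h t = h' t" "s < 5" "1 \<le> i" "i < max_digit s"
  shows "split_conditions h s i \<longleftrightarrow> split_conditions h' s i"
proof -
  have "0 \<le> core_min s" "0 \<le> gap_left s i" "0 \<le> gap_right s i" "0 \<le> node_right s i"
    using node_order[OF assms(2-4)] core_min_bounds[of s] by auto
  then have "h (core_min s) = h' (core_min s)" "h (gap_left s i) = h' (gap_left s i)"
    "h (gap_right s i) = h' (gap_right s i)" "h (node_right s i) = h' (node_right s i)"
    using assms(1) by auto
  moreover have "gap_dominates s i u v \<Longrightarrow> h u = h' u \<and> h v = h' v" for u v
    using assms(1) by (auto simp: gap_dominates_def)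
  ultimately show ?thesis unfolding split_conditions_def using assms(1)
    by (smt (verit, best))
qed

lemma split_conditions_word:
  assumes a: "4 \<le> a" and w: "admissible w" and i: "1 \<le> i" "i < max_digit (word_state w)"
  shows "split_conditions (log_val a w) (word_state w) i \<or>
    split_conditions (\<lambda>t. - log_val a w t) (word_state w) i"
proof -
  obtain p p' q q' where pos: "0 < p" "0 \<le> p'" "0 < q" "0 \<le> q'" and le: "p' \<le> p" "q' \<le> q"
    and det: "p' * q - p * q' = 1 \<or> p' * q - p * q' = - 1"
    and s2: "word_state w = 2 \<longrightarrow> 4 * p \<le> 5 * p' \<and> 4 * q \<le> 5 * q'"
    and eq: "\<And>t. 0 \<le> t \<Longrightarrow> a + tailcf w t = moebius p p' q q' t"
    using word_moebius[OF a w] by auto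
  note node = word_state_less i
  show ?thesis
  proof (cases "p' * q - p * q' = 1")
    case True
    then have "split_conditions (\<lambda>t. ln (moebius p p' q q' t)) (word_state w) i"
      by (intro split_conditions_moebius[OF node pos _ le s2]) simp
    then show ?thesis
      using split_conditions_cong[OF _ node, of "log_val a w" "\<lambda>t. ln (moebius p p' q q' t)"]
      by (simp add: log_val_def eq)
  next
    case False
    then have "0 < q' * p - q * p'" using det by (simp add: mult.commute)
    then have "split_conditions (\<lambda>t. ln (moebius q q' p p' t)) (word_state w) i"
      using s2 by (intro split_conditions_moebius[OF node pos(3,4,1,2) _ le(2,1)]) auto
    then show ?thesis
      using split_conditions_cong[OF _ node, of "\<lambda>t. - log_val a w t" "\<lambda>t. ln (moebius q q' p p' t)"]
      by (simp add: log_val_def eq ln_moebius_swap[OF pos])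
  qed
qed

type_synonym node = "real \<times> nat list \<times> nat"

text \<open>The node \<open>(a, w, i)\<close> stands for all values \<open>a + [0; w, d, \<dots>]\<close> with \<open>d \<ge> i\<close>. Removing a gap
  leaves the nodes with \<open>d = i\<close> and with \<open>d \<ge> i + 1\<close>.\<close>

fun valid :: "node \<Rightarrow> bool" where
  "valid (a, w, i) \<longleftrightarrow> 4 \<le> a \<and> admissible w \<and> 1 \<le> i \<and> i < max_digit (word_state w)"

fun node_lo :: "node \<Rightarrow> real" where
  "node_lo (a, w, i) = min (log_val a w (core_min (word_state w))) (log_val a w (node_right (word_state w) i))"

fun node_hi :: "node \<Rightarrow> real" where
  "node_hi (a, w, i) = max (log_val a w (core_min (word_state w))) (log_val a w (node_right (word_state w) i))"

fun node_gap :: "node \<Rightarrow> real" where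
  "node_gap (a, w, i) = \<bar>log_val a w (gap_right (word_state w) i) - log_val a w (gap_left (word_state w) i)\<bar>"

text \<open>The weight 4 exceeds every \<open>i\<close> of a valid node, so lengthening the word
  increases the depth even though \<open>i\<close> falls back to 1.\<close>

fun depth :: "node \<Rightarrow> nat" where
  "depth (a, w, i) = 4 * length w + i"

definition descends :: "node \<Rightarrow> node \<Rightarrow> bool" where
  "descends n n' \<longleftrightarrow> fst n' = fst n \<and> prefix (fst (snd n)) (fst (snd n')) \<and> depth n < depth n'"

fun child1 :: "node \<Rightarrow> node" where
  "child1 (a, w, i) = (a, w @ [i], 1)"

text \<open>If only the largest digit remains, there is no further gap at this level, and the node
  passes to the cylinder of that digit.\<close>

fun child2 :: "node \<Rightarrow> node" where
  "child2 (a, w, i) = (if i + 1 < max_digit (word_state w) then (a, w, i + 1) else (a, w @ [i + 1], 1))"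

text \<open>\<open>c\<close> is the lower child and \<open>d\<close> the upper one. Inequalities
  take the place of equalities because rounding lets a child protrude beyond its parent.\<close>

definition splits :: "node \<Rightarrow> node \<Rightarrow> node \<Rightarrow> bool" where
  "splits n c d \<longleftrightarrow> node_lo c \<le> node_lo n \<and> node_hi n \<le> node_hi d \<and> node_lo d - node_hi c \<le> node_gap n \<and>
     node_gap n \<le> node_hi c - node_lo c \<and> node_gap n \<le> node_hi d - node_lo d \<and>
     node_gap c \<le> node_gap n \<and> node_gap d \<le> node_gap n"

lemma max_digit_gt: "1 < max_digit s" by (simp add: max_digit_def)

lemma valid_children:
  assumes "valid n"
  shows "valid (child1 n)" "valid (child2 n)" "descends n (child1 n)" "descends n (child2 n)"
proof -
  obtain a w i where n: "n = (a, w, i)" by (cases n)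
  have "i < 4" using assms n by (auto simp: max_digit_def split: if_splits)
  then show "valid (child1 n)" "valid (child2 n)" "descends n (child1 n)" "descends n (child2 n)"
    using assms n max_digit_gt by (auto simp: admissible_snoc descends_def simp del: One_nat_def)
qed

lemma node_right_1: "node_right s 1 = core_max s"
  by (simp add: node_right_def core_max_def)

lemma splits_children:
  assumes "valid n"
  shows "splits n (child1 n) (child2 n) \<or> splits n (child2 n) (child1 n)"
proof -
  obtain a w i where n: "n = (a, w, i)" by (cases n)
  define s where "s = word_state w"
  have v: "4 \<le> a" "admissible w" "1 \<le> i" "i < max_digit s" using assms n by (auto simp: s_def)
  note node = word_state_less[of w, folded s_def] v(3,4)
  define L where "L = log_val a w"
  define t0 t1 t2 t3 where "t0 = core_min s" and "t1 = gap_left s i" and "t2 = gap_right s i" and "t3 = node_right s i"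
  note tdefs = t0_def t1_def t2_def t3_def
  have ord: "0 < t0" "t0 < t1" "t1 < t2" "t2 < t3"
    using node_order[OF node] core_min_bounds[of s] by (auto simp: tdefs)
  have lo_n: "node_lo n = min (L t0) (L t3)" and hi_n: "node_hi n = max (L t0) (L t3)"
    and gap_n: "node_gap n = \<bar>L t2 - L t1\<bar>"
    by (simp_all add: n L_def tdefs s_def)
  have lo_1: "node_lo (child1 n) = min (L t2) (L t3)" and hi_1: "node_hi (child1 n) = max (L t2) (L t3)"
    using node_right_1[of "overlap s i"]
    by (simp_all add: n L_def tdefs log_val_snoc word_state_snoc s_def[symmetric] gap_right_def node_right_def
        min.commute max.commute del: One_nat_def overlap.simps)
  obtain u1 v1 where g1: "gap_dominates s i u1 v1" "node_gap (child1 n) = \<bar>L v1 - L u1\<bar>"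
    using gap_dominates_cylinder[OF node]
    by (auto simp: n L_def log_val_snoc word_state_snoc s_def[symmetric] abs_minus_commute simp del: One_nat_def overlap.simps)
  \<comment> \<open>\<open>x\<close> is the far end of the second child: \<open>t0\<close> itself,
    or a point at or below \<open>t0\<close> when only the largest digit remains.\<close>
  have "\<exists>x u v. 0 \<le> x \<and> x \<le> t0 \<and> node_lo (child2 n) = min (L x) (L t1) \<and> node_hi (child2 n) = max (L x) (L t1) \<and>
    gap_dominates s i u v \<and> node_gap (child2 n) = \<bar>L v - L u\<bar>"
  proof (cases "i + 1 < max_digit s")
    case True
    then have "node_lo (child2 n) = min (L t0) (L t1) \<and> node_hi (child2 n) = max (L t0) (L t1)"
      by (simp add: n L_def tdefs s_def[symmetric] node_right_def gap_left_def add.commute del: overlap.simps)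
    moreover have "node_gap (child2 n) = \<bar>L (gap_right s (i + 1)) - L (gap_left s (i + 1))\<bar>"
      using True by (simp add: n L_def s_def[symmetric])
    ultimately show ?thesis using gap_dominates_next[OF node(1,2) True] ord
      by (intro exI[of _ t0] exI[of _ "gap_left s (i + 1)"] exI[of _ "gap_right s (i + 1)"]) auto
  next
    case False
    then have K: "max_digit s = i + 1" using v(4) by simp
    define x where "x = 1 / (real (i + 1) + core_max (overlap s (i + 1)))"
    have "0 < core_max (overlap s (i + 1))"
      using core_min_bounds(1)[of "overlap (overlap s (i+1)) 1"] by (simp add: core_max_def del: overlap.simps)
    then have "0 \<le> x" by (simp add: x_def)
    moreover have "x \<le> t0" using core_min_cover[OF node(1)] K by (simp add: x_def tdefs)
    moreover have "node_lo (child2 n) = min (L x) (L t1)" "node_hi (child2 n) = max (L x) (L t1)"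
      using False node_right_1[of "overlap s (i + 1)"]
      by (simp_all add: n L_def tdefs log_val_snoc word_state_snoc s_def[symmetric] gap_left_def x_def add.commute
          min.commute max.commute del: One_nat_def overlap.simps)
    moreover have "gap_dominates s i (1 / (real (i + 1) + gap_right (overlap s (i + 1)) 1)) (1 / (real (i + 1) + gap_left (overlap s (i + 1)) 1))"
      using gap_dominates_last[OF node(1,2)] K by simp
    moreover have "node_gap (child2 n) = \<bar>L (1 / (real (i + 1) + gap_left (overlap s (i + 1)) 1)) - L (1 / (real (i + 1) + gap_right (overlap s (i + 1)) 1))\<bar>"
      using False by (simp add: n L_def log_val_snoc word_state_snoc s_def[symmetric] abs_minus_commute del: One_nat_def overlap.simps)
    ultimately show ?thesis by blast
  qed
  then obtain x u2 v2 where x: "0 \<le> x" "x \<le> t0" and lo_2: "node_lo (child2 n) = min (L x) (L t1)"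
    and hi_2: "node_hi (child2 n) = max (L x) (L t1)"
    and g2: "gap_dominates s i u2 v2" "node_gap (child2 n) = \<bar>L v2 - L u2\<bar>" by blast
  have uv: "0 \<le> u1" "u1 < v1" "0 \<le> u2" "u2 < v2" using g1(1) g2(1) by (auto simp: gap_dominates_def)
  have sc: "split_conditions L s i \<or> split_conditions (\<lambda>t. - L t) s i"
    using split_conditions_word[OF v(1,2,3)] v(4) by (simp add: L_def s_def)
  then show ?thesis
  proof
    assume c: "split_conditions L s i"
    have mono: "L y \<le> L z" if "0 \<le> y" "y \<le> z" for y z
      using c that by (cases "y = z") (auto simp: split_conditions_def intro: less_imp_le)
    have "L x \<le> L t0" "L t0 \<le> L t1" "L t1 \<le> L t2" "L t2 \<le> L t3" "L u1 \<le> L v1" "L u2 \<le> L v2"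
      using x ord uv by (auto intro!: mono)
    moreover have "L t2 - L t1 \<le> L t1 - L t0" "L t2 - L t1 \<le> L t3 - L t2" "L v1 - L u1 \<le> L t2 - L t1"
      "L v2 - L u2 \<le> L t2 - L t1"
      using c g1(1) g2(1) by (auto simp: split_conditions_def tdefs)
    ultimately have "splits n (child2 n) (child1 n)"
      unfolding splits_def lo_n hi_n gap_n lo_1 hi_1 lo_2 hi_2 g1(2) g2(2) by auto
    then show ?thesis ..
  next
    assume c: "split_conditions (\<lambda>t. - L t) s i"
    have mono: "L z \<le> L y" if "0 \<le> y" "y \<le> z" for y z
      using c that by (cases "y = z") (auto simp: split_conditions_def intro: less_imp_le)
    have "L t0 \<le> L x" "L t1 \<le> L t0" "L t2 \<le> L t1" "L t3 \<le> L t2" "L v1 \<le> L u1" "L v2 \<le> L u2"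
      using x ord uv by (auto intro!: mono)
    moreover have "L t1 - L t2 \<le> L t0 - L t1" "L t1 - L t2 \<le> L t2 - L t3" "L u1 - L v1 \<le> L t1 - L t2"
      "L u2 - L v2 \<le> L t1 - L t2"
      using c g1(1) g2(1) by (auto simp: split_conditions_def tdefs)
    ultimately have "splits n (child1 n) (child2 n)"
      unfolding splits_def lo_n hi_n gap_n lo_1 hi_1 lo_2 hi_2 g1(2) g2(2) by auto
    then show ?thesis ..
  qed
qed


section \<open>Sums of two Cantor sets\<close>

text \<open>Neither interval is shorter than the gap of the other, so neither fits strictly inside
  that gap; and \<open>x\<close> lies in the sum of the two intervals.\<close>

definition linked :: "real \<Rightarrow> node \<Rightarrow> node \<Rightarrow> bool" where
  "linked x m n \<longleftrightarrow> valid m \<and> valid n \<and> node_gap m \<le> node_hi n - node_lo n \<and> node_gap n \<le> node_hi m - node_lo m \<and>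
     node_lo m + node_lo n \<le> x \<and> x \<le> node_hi m + node_hi n"

lemma linked_sym: "linked x m n \<Longrightarrow> linked x n m"
  by (simp add: linked_def add.commute)

lemma descends_trans: "descends l m \<Longrightarrow> descends m n \<Longrightarrow> descends l n"
  by (auto simp: descends_def intro: prefix_order.trans)

text \<open>Splitting the node with the larger gap keeps the pair linked: its gap is at most the length of
  the other node, and its two pieces are at least as long as the gap.\<close>

lemma linked_child:
  assumes l: "linked x m n" and le: "node_gap n \<le> node_gap m"
  shows "\<exists>m'. descends m m' \<and> linked x m' n"
proof -
  have v: "valid m" using l by (simp add: linked_def)
  obtain c d where cd: "splits m c d" "valid c" "valid d" "descends m c" "descends m d"
    using splits_children[OF v] valid_children[OF v] by blast
  have "linked x c n \<or> linked x d n"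
    using cd(1-3) l le by (cases "x \<le> node_hi c + node_hi n") (auto simp: linked_def splits_def)
  then show ?thesis using cd by blast
qed

lemma node_gap_le:
  assumes "valid n"
  shows "node_gap n \<le> (1/2) ^ length (fst (snd n))"
proof -
  obtain a w i where n: "n = (a, w, i)" by (cases n)
  then have v: "4 \<le> a" "admissible w" "1 \<le> i" "i < max_digit (word_state w)" using assms by auto
  show ?thesis
    using log_val_close[OF v(1) admissible_digits[OF v(2)], of "gap_right (word_state w) i" "gap_left (word_state w) i"]
      node_order[OF word_state_less v(3,4)] core_min_bounds(1)[of "word_state w"] by (simp add: n)
qed

lemma node_gap_pos:
  assumes "valid n"
  shows "0 < node_gap n"
proof -
  obtain a w i where n: "n = (a, w, i)" by (cases n)
  then have v: "4 \<le> a" "admissible w" "1 \<le> i" "i < max_digit (word_state w)" using assms by auto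
  have "0 \<le> gap_left (word_state w) i" "gap_left (word_state w) i < gap_right (word_state w) i"
    using node_order[OF word_state_less v(3,4)] core_min_bounds(1)[of "word_state w"] by auto
  then show ?thesis
    using split_conditions_word[OF v] by (fastforce simp: n split_conditions_def)
qed

lemma node_gap_small:
  assumes "0 < e"
  shows "\<exists>N. \<forall>n. valid n \<longrightarrow> N \<le> depth n \<longrightarrow> node_gap n < e"
proof -
  obtain k :: nat where k: "(1/2) ^ k < e" using real_arch_pow_inv[OF assms, of "1/2"] by auto
  have "node_gap n < e" if v: "valid n" and d: "4 * k + 4 \<le> depth n" for n
  proof -
    obtain a w i where n: "n = (a, w, i)" by (cases n)
    have "i < 4" using v n by (auto simp: max_digit_def split: if_splits)
    then have "k \<le> length w" using d n by simp
    then have "(1/2 :: real) ^ length w \<le> (1/2) ^ k" by (intro power_decreasing) auto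
    moreover have "fst (snd n) = w" by (simp add: n)
    ultimately show ?thesis using node_gap_le[OF v] k by (metis order.strict_trans1 order.trans)
  qed
  then show ?thesis by blast
qed

text \<open>The second node cannot be split forever, since its gaps shrink below the gap of the first.\<close>

lemma linked_descend_left:
  assumes "linked x m n"
  shows "\<exists>m' n'. descends m m' \<and> (n' = n \<or> descends n n') \<and> linked x m' n'"
proof -
  have "valid m" using assms by (simp add: linked_def)
  then obtain N where N: "\<And>n. valid n \<Longrightarrow> N \<le> depth n \<Longrightarrow> node_gap n < node_gap m"
    using node_gap_small[OF node_gap_pos] by blast
  show ?thesis using assms
  proof (induction "N - depth n" arbitrary: n rule: less_induct)
    case less
    show ?case
    proof (cases "node_gap n \<le> node_gap m")
      case True
      then show ?thesis using linked_child[OF less.prems] by blast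
    next
      case False
      then have "depth n < N" using N[of n] less.prems by (fastforce simp: linked_def)
      moreover obtain n1 where n1: "descends n n1" "linked x m n1"
        using linked_child[OF linked_sym[OF less.prems]] False linked_sym by (meson linear)
      moreover have "depth n < depth n1" using n1 by (simp add: descends_def)
      ultimately obtain m' n' where "descends m m'" "n' = n1 \<or> descends n1 n'" "linked x m' n'"
        using less.hyps[of n1] by fastforce
      then show ?thesis using n1 descends_trans by blast
    qed
  qed
qed

text \<open>Both nodes have to move: otherwise one word could stay finite while the other grows, and
  no pair of infinite words would result.\<close>

lemma linked_descend:
  assumes "linked x m n"
  shows "\<exists>m' n'. descends m m' \<and> descends n n' \<and> linked x m' n'"
proof -
  obtain m1 n1 where 1: "descends m m1" "n1 = n \<or> descends n n1" "linked x m1 n1"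
    using linked_descend_left[OF assms] by blast
  obtain n2 m2 where "descends n1 n2" "m2 = m1 \<or> descends m1 m2" "linked x n2 m2"
    using linked_descend_left[OF linked_sym[OF 1(3)]] by blast
  then show ?thesis using 1 descends_trans linked_sym by blast
qed

lemma linked_chain:
  assumes "linked x m n"
  shows "\<exists>M N. M 0 = m \<and> N 0 = n \<and> (\<forall>k. linked x (M k) (N k) \<and> descends (M k) (M (Suc k)) \<and> descends (N k) (N (Suc k)))"
proof -
  have "\<exists>f. \<forall>k. (linked x (fst (f k)) (snd (f k)) \<and> (k = 0 \<longrightarrow> f k = (m, n))) \<and>
    (descends (fst (f k)) (fst (f (Suc k))) \<and> descends (snd (f k)) (snd (f (Suc k))))"
  proof (rule dependent_nat_choice)
    show "\<exists>f. linked x (fst f) (snd f) \<and> (0 = (0::nat) \<longrightarrow> f = (m, n))" using assms by (intro exI[of _ "(m, n)"]) simp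
  next
    fix f and k :: nat
    assume "linked x (fst f) (snd f) \<and> (k = 0 \<longrightarrow> f = (m, n))"
    then obtain m' n' where "descends (fst f) m'" "descends (snd f) n'" "linked x m' n'"
      using linked_descend[of x "fst f" "snd f"] by blast
    then show "\<exists>g. (linked x (fst g) (snd g) \<and> (Suc k = 0 \<longrightarrow> g = (m, n))) \<and>
      descends (fst f) (fst g) \<and> descends (snd f) (snd g)"
      by (intro exI[of _ "(m', n')"]) simp
  qed
  then obtain f where f: "\<And>k. linked x (fst (f k)) (snd (f k))" "f 0 = (m, n)"
    "\<And>k. descends (fst (f k)) (fst (f (Suc k))) \<and> descends (snd (f k)) (snd (f (Suc k)))" by auto
  show ?thesis
    by (rule exI[of _ "fst \<circ> f"], rule exI[of _ "snd \<circ> f"]) (simp add: f)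
qed

definition admissible_seq :: "(nat \<Rightarrow> nat) \<Rightarrow> bool" where
  "admissible_seq U \<longleftrightarrow> (\<forall>j. admissible (map U [0..<j]))"

lemma chain_limit:
  assumes ch: "\<And>k. valid (M k)" "\<And>k. descends (M k) (M (Suc k))"
  shows "\<exists>U. admissible_seq U \<and> (\<forall>j. \<exists>K. \<forall>k\<ge>K. prefix (map U [0..<j]) (fst (snd (M k))))"
proof -
  define W where "W k = fst (snd (M k))" for k
  have adm: "admissible (W k)" for k using ch(1)[of k] by (cases "M k") (auto simp: W_def)
  have pre: "prefix (W k) (W l)" if "k \<le> l" for k l
    using that
  proof (induction rule: dec_induct)
    case (step l)
    then show ?case using ch(2)[of l] by (auto simp: descends_def W_def intro: prefix_order.trans)
  qed simp
  have dep: "k \<le> depth (M k)" for k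
  proof (induction k)
    case (Suc k)
    then show ?case using ch(2)[of k] by (simp add: descends_def)
  qed simp
  \<comment> \<open>The depth is \<open>4 * length w + i\<close> with \<open>i < 4\<close>, so depth
    at least \<open>4 * j + 8\<close> forces a word longer than \<open>j\<close>.\<close>
  have len: "j < length (W (4 * j + 8))" for j
  proof -
    obtain a w i where n: "M (4 * j + 8) = (a, w, i)" by (cases "M (4 * j + 8)")
    have "i < 4" using ch(1)[of "4 * j + 8"] n by (auto simp: max_digit_def split: if_splits)
    then show ?thesis using dep[of "4 * j + 8"] by (simp add: n W_def)
  qed
  define U where "U j = W (4 * j + 8) ! j" for j
  have UW: "map U [0..<j] = take j (W k)" if k: "4 * j + 8 \<le> k" for j k
  proof (rule nth_equalityI)
    have "length (W (4 * j + 8)) \<le> length (W k)" using pre[OF k] by (rule prefix_length_le)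
    then have l: "j < length (W k)" using len[of j] by simp
    then show "length (map U [0..<j]) = length (take j (W k))" by simp
    fix i assume "i < length (map U [0..<j])"
    then have i: "i < j" by simp
    have "prefix (W (4 * i + 8)) (W k)" using i k by (intro pre) simp
    then have "W k ! i = W (4 * i + 8) ! i" using len[of i] by (auto simp: prefix_def nth_append)
    then show "map U [0..<j] ! i = take j (W k) ! i" using i l by (simp add: U_def)
  qed
  have "admissible_seq U"
    unfolding admissible_seq_def
  proof
    fix j
    have "admissible (take j (W (4 * j + 8)))"
      using adm[of "4 * j + 8"] by (auto simp: admissible_def min_def)
    then show "admissible (map U [0..<j])" using UW[of j "4 * j + 8"] by simp
  qed
  moreover have "\<forall>k\<ge>4 * j + 8. prefix (map U [0..<j]) (W k)" for j
    using UW take_is_prefix by metis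
  ultimately show ?thesis unfolding W_def by blast
qed

lemma node_values_close:
  assumes v: "valid n" and p: "prefix w (fst (snd n))" and t: "0 \<le> t" "t \<le> 1"
  shows "\<bar>node_lo n - log_val (fst n) w t\<bar> \<le> (1/2) ^ length w" "\<bar>node_hi n - log_val (fst n) w t\<bar> \<le> (1/2) ^ length w"
proof -
  obtain a w' i where n: "n = (a, w', i)" by (cases n)
  then have v: "4 \<le> a" "admissible w'" "1 \<le> i" "i < max_digit (word_state w')" using v by auto
  obtain w'' where w'': "w' = w @ w''" using p n by (auto simp: prefix_def)
  have d: "\<forall>d\<in>set w. 1 \<le> d" "\<forall>d\<in>set w''. 1 \<le> d" using admissible_digits[OF v(2)] w'' by auto
  have "\<bar>log_val a w' s - log_val a w t\<bar> \<le> (1/2) ^ length w" if "0 \<le> s" "s \<le> 1" for s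
    using log_val_close[OF v(1) d(1), of "tailcf w'' s" t] tailcf_bounds[OF d(2) that] t
    by (simp add: w'' log_val_def tailcf_append)
  moreover have "0 \<le> core_min (word_state w')" "core_min (word_state w') \<le> 1"
    "0 \<le> node_right (word_state w') i" "node_right (word_state w') i \<le> 1"
    using node_order[OF word_state_less v(3,4)] core_min_bounds[of "word_state w'"] by auto
  ultimately show "\<bar>node_lo n - log_val (fst n) w t\<bar> \<le> (1/2) ^ length w"
    "\<bar>node_hi n - log_val (fst n) w t\<bar> \<le> (1/2) ^ length w"
    by (auto simp: n min_def max_def)
qed

lemma linked_representation:
  assumes l: "linked x (a, [], 1) (b, [], 1)"
  shows "\<exists>U V. admissible_seq U \<and> admissible_seq V \<and>
    (\<forall>j t t'. 0 \<le> t \<longrightarrow> t \<le> 1 \<longrightarrow> 0 \<le> t' \<longrightarrow> t' \<le> 1 \<longrightarrow>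
      \<bar>log_val a (map U [0..<j]) t + log_val b (map V [0..<j]) t' - x\<bar> \<le> 2 * (1/2) ^ j)"
proof -
  obtain M N where M: "M 0 = (a, [], 1)" and N: "N 0 = (b, [], 1)"
    and ch: "\<And>k. linked x (M k) (N k)" "\<And>k. descends (M k) (M (Suc k))" "\<And>k. descends (N k) (N (Suc k))"
    using linked_chain[OF l] by blast
  have v: "valid (M k)" "valid (N k)" for k using ch(1)[of k] by (auto simp: linked_def)
  have "fst (M k) = a \<and> fst (N k) = b" for k
  proof (induction k)
    case (Suc k)
    then show ?case using ch(2,3)[of k] by (simp add: descends_def)
  qed (simp add: M N)
  then have ab: "fst (M k) = a" "fst (N k) = b" for k by auto
  obtain U where U: "admissible_seq U" "\<And>j. \<exists>K. \<forall>k\<ge>K. prefix (map U [0..<j]) (fst (snd (M k)))"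
    using chain_limit[of M, OF v(1) ch(2)] by blast
  obtain V where V: "admissible_seq V" "\<And>j. \<exists>K. \<forall>k\<ge>K. prefix (map V [0..<j]) (fst (snd (N k)))"
    using chain_limit[of N, OF v(2) ch(3)] by blast
  have "\<bar>log_val a (map U [0..<j]) t + log_val b (map V [0..<j]) t' - x\<bar> \<le> 2 * (1/2) ^ j"
    if t: "0 \<le> t" "t \<le> 1" "0 \<le> t'" "t' \<le> 1" for j t t'
  proof -
    obtain K1 K2 where K: "\<forall>k\<ge>K1. prefix (map U [0..<j]) (fst (snd (M k)))" "\<forall>k\<ge>K2. prefix (map V [0..<j]) (fst (snd (N k)))"
      using U(2) V(2) by meson
    define k where "k = max K1 K2"
    have p: "prefix (map U [0..<j]) (fst (snd (M k)))" "prefix (map V [0..<j]) (fst (snd (N k)))"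
      using K by (auto simp: k_def)
    have "node_lo (M k) + node_lo (N k) \<le> x" "x \<le> node_hi (M k) + node_hi (N k)"
      using ch(1)[of k] by (auto simp: linked_def)
    then show ?thesis
      using node_values_close[OF v(1)[of k] p(1) t(1,2)] node_values_close[OF v(2)[of k] p(2) t(3,4)]
      unfolding ab abs_le_iff by simp
  qed
  then show ?thesis using U(1) V(1) by blast
qed


lemma linked_root:
  fixes a b :: nat
  assumes a: "4 \<le> a" and b: "4 \<le> b" "a \<le> b" "b \<le> a + 1"
    and z: "(a + 2613 / 10000) * (b + 2613 / 10000) \<le> z" "z \<le> (a + 10000 / 12087) * (b + 10000 / 12087)"
  shows "linked (ln z) (real a, [], 1) (real b, [], 1)"
proof -
  have ab: "4 \<le> real a" "4 \<le> real b" "real a \<le> real b" "real b \<le> real a + 1" using a b by auto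
  have ws: "word_state [] = 1" by (simp add: word_state_def)
  have lo: "node_lo (real c, [], 1) = ln (c + 2613 / 10000)"
    and hi: "node_hi (real c, [], 1) = ln (c + 10000 / 12087)"
    and gap: "node_gap (real c, [], 1) = ln (c + 1509 / 2759) - ln (c + 1250 / 2759)" if "4 \<le> real c" for c :: nat
    using that by (auto simp: ws log_val_def node_right_simps gap_left_simps gap_right_simps core_min_def
        min_def max_def simp del: One_nat_def)
  have len: "ln (c + 1509 / 2759) - ln (c + 1250 / 2759) \<le> ln (d + 10000 / 12087) - ln (d + 2613 / 10000)"
    if "4 \<le> c" "4 \<le> d" "c \<le> d + 1" "d \<le> c + 1" for c d :: real
  proof -
    have "(c + 1509 / 2759) * (d + 2613 / 10000) \<le> (d + 10000 / 12087) * (c + 1250 / 2759)"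
    proof -
      have "c * (1 / 2) \<le> c * (10000 / 12087 - 2613 / 10000)" using that by (intro mult_left_mono) auto
      moreover have "d * (1509 / 2759 - 1250 / 2759) \<le> d * (1 / 10)" using that by (intro mult_left_mono) auto
      moreover have "(1509 / 2759 :: real) * (2613 / 10000) \<le> (10000 / 12087) * (1250 / 2759)" by simp
      moreover have "(d + 10000 / 12087) * (c + 1250 / 2759) - (c + 1509 / 2759) * (d + 2613 / 10000)
        = c * (10000 / 12087 - 2613 / 10000) - d * (1509 / 2759 - 1250 / 2759)
          + ((10000 / 12087) * (1250 / 2759) - (1509 / 2759) * (2613 / 10000))"
        unfolding distrib_left distrib_right right_diff_distrib by simp
      ultimately show ?thesis using that by linarith
    qed
    then have "ln ((c + 1509 / 2759) * (d + 2613 / 10000)) \<le> ln ((d + 10000 / 12087) * (c + 1250 / 2759))"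
      using that by (subst ln_le_cancel_iff) auto
    then show ?thesis using that by (simp add: ln_mult)
  qed
  have zpos: "0 < (real a + 2613 / 10000) * (real b + 2613 / 10000)" using ab by simp
  have "ln ((a + 2613 / 10000) * (b + 2613 / 10000)) \<le> ln z" "ln z \<le> ln ((a + 10000 / 12087) * (b + 10000 / 12087))"
    using z zpos less_le_trans[OF zpos z(1)] by (auto intro!: ln_mono)
  then have "ln (a + 2613 / 10000) + ln (b + 2613 / 10000) \<le> ln z" "ln z \<le> ln (a + 10000 / 12087) + ln (b + 10000 / 12087)"
    using ab by (simp_all add: ln_mult)
  moreover have "valid (real c, [], 1)" if "4 \<le> real c" for c :: nat
    using that by (simp add: ws admissible_def max_digit_def)
  ultimately show ?thesis
    unfolding linked_def lo[OF ab(1)] lo[OF ab(2)] hi[OF ab(1)] hi[OF ab(2)] gap[OF ab(1)] gap[OF ab(2)]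
    using len[of a b] len[of b a] ab by auto
qed

lemma peak_exists:
  assumes "182 / 10 \<le> z"
  shows "\<exists>a b U V. 4 \<le> a \<and> 4 \<le> b \<and> admissible_seq U \<and> admissible_seq V \<and>
    (\<forall>j t t'. 0 \<le> t \<longrightarrow> t \<le> 1 \<longrightarrow> 0 \<le> t' \<longrightarrow> t' \<le> 1 \<longrightarrow>
      \<bar>log_val (real a) (map U [0..<j]) t + log_val (real b) (map V [0..<j]) t' - ln z\<bar> \<le> 2 * (1/2) ^ j)"
proof -
  \<comment> \<open>2613/10000 is \<open>core_min 1\<close>, the lower end of the root interval;
    \<open>k \<ge> 4\<close> follows since 4.2613 squared is below 18.2.\<close>
  define k where "k = nat \<lfloor>sqrt z - 2613 / 10000\<rfloor>"
  have "42613 / 10000 \<le> sqrt z" using assms by (intro real_le_rsqrt) (simp add: power2_eq_square)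
  then have k: "4 \<le> k" "real k + 2613 / 10000 \<le> sqrt z" "sqrt z < real k + 1 + 2613 / 10000"
    unfolding k_def by linarith+
  have sq: "sqrt z * sqrt z = z" using assms by simp
  have zlo: "(real k + 2613 / 10000) * (real k + 2613 / 10000) \<le> z"
    using mult_mono[OF k(2,2)] k(1) sq by simp
  have zhi: "z < (real k + 1 + 2613 / 10000) * (real k + 1 + 2613 / 10000)"
    using mult_strict_mono[OF k(3,3)] k(1) sq assms by simp
  have k4: "4 \<le> real k" using k(1) by simp
  have "\<exists>a b :: nat. 4 \<le> a \<and> 4 \<le> b \<and> linked (ln z) (real a, [], 1) (real b, [], 1)"
  proof (cases "z \<le> (real k + 10000 / 12087) * (real k + 10000 / 12087)")
    case True
    then show ?thesis using linked_root[of k k z] k(1) zlo by auto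
  next
    case False
    \<comment> \<open>The range of products for \<open>(k, k + 1)\<close> overlaps that for
      \<open>(k, k)\<close> from above and reaches the start of that for
      \<open>(k + 1, k + 1)\<close>.\<close>
    have "(real k + 2613 / 10000) * (real (k + 1) + 2613 / 10000) \<le> (real k + 10000 / 12087) * (real k + 10000 / 12087)"
      using k4 by (simp add: algebra_simps)
    moreover have "(real k + 1 + 2613 / 10000) * (real k + 1 + 2613 / 10000) \<le> (real k + 10000 / 12087) * (real (k + 1) + 10000 / 12087)"
      using k4 by (simp add: algebra_simps)
    ultimately have "linked (ln z) (real k, [], 1) (real (k + 1), [], 1)"
      using False zhi k(1) by (intro linked_root) auto
    then show ?thesis using k(1) by (intro exI[of _ k] exI[of _ "k + 1"]) auto
  qed
  then show ?thesis using linked_representation by meson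
qed


section \<open>Irrationals with prescribed partial quotients\<close>

definition tail_value :: "(nat \<Rightarrow> nat) \<Rightarrow> nat \<Rightarrow> real" where
  "tail_value X k = lim (\<lambda>n. tailcf (map X [k..<k + n]) 0)"

locale digits =
  fixes X :: "nat \<Rightarrow> nat"
  assumes X: "\<And>n. 1 \<le> X n"
begin

lemma tail_value_tendsto: "(\<lambda>n. tailcf (map X [k..<k + n]) 0) \<longlonglongrightarrow> tail_value X k"
proof -
  define s where "s n = tailcf (map X [k..<k + n]) 0" for n
  have close: "\<bar>s m - s n\<bar> \<le> 2 * (1/2) ^ n" if "n \<le> m" for m n
  proof -
    have "[k..<k + m] = [k..<k + n] @ [k + n..<k + m]"
      using that upt_add_eq_append[of k "k + n" "m - n"] by simp
    then have "s m = tailcf (map X [k..<k + n]) (tailcf (map X [k + n..<k + m]) 0)"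
      by (simp add: s_def tailcf_append)
    then show ?thesis
      using tailcf_close[of "map X [k..<k + n]" "tailcf (map X [k + n..<k + m]) 0" 0]
        tailcf_bounds[of "map X [k + n..<k + m]" 0] X by (simp add: s_def)
  qed
  have "Cauchy s"
  proof (rule metric_CauchyI)
    fix e :: real assume "0 < e"
    then obtain N where N: "(1/2) ^ N < e / 2" using real_arch_pow_inv[of "e / 2" "1/2"] by auto
    have less: "\<bar>s n - s m\<bar> < e" if "N \<le> m" "m \<le> n" for m n
    proof -
      have "(1/2 :: real) ^ m \<le> (1/2) ^ N" using that by (intro power_decreasing) auto
      moreover have "\<bar>s n - s m\<bar> \<le> 2 * (1/2) ^ m" using that by (intro close) simp
      ultimately show ?thesis using N by linarith
    qed
    show "\<exists>M. \<forall>m\<ge>M. \<forall>n\<ge>M. dist (s m) (s n) < e"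
      by (rule exI[of _ N]) (metis dist_commute dist_real_def less linear)
  qed
  then have "s \<longlonglongrightarrow> lim s" by (simp add: Cauchy_convergent_iff convergent_LIMSEQ_iff)
  then show ?thesis by (simp add: s_def[abs_def] tail_value_def)
qed

lemma tail_value_bounds: "0 \<le> tail_value X k" "tail_value X k \<le> 1"
proof -
  have b: "0 \<le> tailcf (map X [k..<k + n]) 0" "tailcf (map X [k..<k + n]) 0 \<le> 1" for n
    using tailcf_bounds[of "map X [k..<k + n]" 0] X by auto
  show "0 \<le> tail_value X k" by (rule LIMSEQ_le_const[OF tail_value_tendsto]) (use b in blast)
  show "tail_value X k \<le> 1" by (rule LIMSEQ_le_const2[OF tail_value_tendsto]) (use b in blast)
qed

lemma tail_value_step: "tail_value X k = 1 / (real (X k) + tail_value X (Suc k))"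
proof -
  have "(\<lambda>n. 1 / (real (X k) + tailcf (map X [Suc k..<Suc k + n]) 0)) \<longlonglongrightarrow> 1 / (real (X k) + tail_value X (Suc k))"
    using tail_value_bounds(1)[of "Suc k"] X[of k]
    by (intro tendsto_intros tail_value_tendsto) linarith
  moreover have "1 / (real (X k) + tailcf (map X [Suc k..<Suc k + n]) 0) = tailcf (map X [k..<k + Suc n]) 0" for n
    by (simp add: upt_conv_Cons del: upt_Suc)
  ultimately have "(\<lambda>n. tailcf (map X [k..<k + Suc n]) 0) \<longlonglongrightarrow> 1 / (real (X k) + tail_value X (Suc k))" by simp
  then show ?thesis
    using LIMSEQ_Suc[OF tail_value_tendsto[of k]] LIMSEQ_unique by blast
qed

lemma tail_value_pos: "0 < tail_value X k"
  using tail_value_step[of k] tail_value_bounds(1)[of "Suc k"] X[of k] by (simp add: add_pos_nonneg)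

lemma tail_value_less_1: "tail_value X k < 1"
  using tail_value_step[of k] tail_value_pos[of "Suc k"] X[of k] by simp

lemma inverse_tail_value: "1 / tail_value X k = real (X k) + tail_value X (Suc k)"
  using tail_value_step[of k] by simp

lemma tail_value_append: "tail_value X k = tailcf (map X [k..<k + j]) (tail_value X (k + j))"
proof (induction j arbitrary: k)
  case (Suc j)
  show ?case using Suc[of "Suc k"] tail_value_step[of k] by (simp add: upt_conv_Cons del: upt_Suc)
qed simp

text \<open>Euclid's algorithm: passing to the next tail replaces the denominator by the smaller
  numerator, an infinite descent.\<close>

lemma tail_value_not_fraction:
  assumes "tail_value X k = real p / real d"
  shows False
  using assms
proof (induction d arbitrary: k p rule: less_induct)
  case (less d)
  have d: "0 < d" using less.prems tail_value_pos[of k] by (cases "d = 0") auto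
  have "0 < real p / real d" "real p / real d < 1"
    using less.prems tail_value_pos[of k] tail_value_less_1[of k] by simp_all
  then have p: "0 < p" "p < d" using d by (simp_all add: zero_less_divide_iff)
  have "tail_value X (Suc k) = real d / real p - real (X k)"
    using inverse_tail_value[of k] less.prems by simp
  then have e: "tail_value X (Suc k) = (real d - real (X k * p)) / real p" using p by (simp add: field_simps)
  then have "real (X k * p) \<le> real d" using tail_value_pos[of "Suc k"] p by (simp add: zero_less_divide_iff)
  then have "X k * p \<le> d" by (simp only: of_nat_le_iff)
  then have "tail_value X (Suc k) = real (d - X k * p) / real p" unfolding e by (simp add: of_nat_diff)
  then show ?case using less.IH[OF p(2)] by blast
qed

lemma inverse_tail_value_irrational: "1 / tail_value X 0 \<notin> \<rat>"
proof
  assume "1 / tail_value X 0 \<in> \<rat>"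
  then have "tail_value X 0 \<in> \<rat>" using Rats_divide[of 1 "1 / tail_value X 0"] by simp
  then obtain m n where "\<bar>tail_value X 0\<bar> = real m / real n" by (rule Rats_abs_nat_div_natE)
  then show False using tail_value_not_fraction tail_value_bounds(1)[of 0] by simp
qed

lemma complete_quotient_tail_value: "complete_quotient (1 / tail_value X 0) k = 1 / tail_value X k"
proof (induction k)
  case (Suc k)
  have "frac (real (X k) + tail_value X (Suc k)) = tail_value X (Suc k)"
    using tail_value_pos[of "Suc k"] tail_value_less_1[of "Suc k"]
    by (simp add: frac_unique_iff)
  then show ?case unfolding complete_quotient.simps(2) Suc by (simp add: inverse_tail_value[of k])
qed simp

lemma partial_quotient_tail_value: "partial_quotient (1 / tail_value X 0) k = int (X k)"
  unfolding partial_quotient_def complete_quotient_tail_value unfolding inverse_tail_value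
  using tail_value_pos[of "Suc k"] tail_value_less_1[of "Suc k"] by (simp add: floor_eq_iff)

lemma rho_inverse_tail_value:
  "rho (1 / tail_value X 0) = limsup (\<lambda>n. ereal
    ((real (X n) + tailcf (rev (map X [0..<n])) 0) * (real (X (Suc n)) + tail_value X (Suc (Suc n)))))"
proof -
  define \<alpha> where "\<alpha> = 1 / tail_value X 0"
  have pq: "partial_quotient \<alpha> n = int (X n)" for n
    unfolding \<alpha>_def by (rule partial_quotient_tail_value)
  \<comment> \<open>\<open>X 0\<close> is positive, so the reversed list keeps its last
    entry.\<close>
  have "backward_quotients \<alpha> n = map int (X n # rev (map X [0..<n]))" for n
    using X[of 0] by (simp add: backward_quotients_def pq rev_map)
  then have backward: "cf (map real_of_int (backward_quotients \<alpha> n)) = real (X n) + tailcf (rev (map X [0..<n])) 0" for n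
    by (simp only: cf_Cons_eq_tailcf[symmetric] map_map o_def)
  have "cf_inf (\<lambda>i. real_of_int (partial_quotient \<alpha> (n + 1 + i))) = complete_quotient \<alpha> (n + 1)" for n
  proof -
    have "\<alpha> \<notin> \<rat>" unfolding \<alpha>_def by (rule inverse_tail_value_irrational)
    then have "cf_inf (\<lambda>i. real_of_int (partial_quotient (complete_quotient \<alpha> (n + 1)) i)) = complete_quotient \<alpha> (n + 1)"
      by (intro cf_inf_partial_quotient complete_quotient_irrational)
    then show ?thesis by (simp only: partial_quotient_def complete_quotient_shift)
  qed
  then have "cf_inf (\<lambda>i. real_of_int (partial_quotient \<alpha> (n + 1 + i))) = 1 / tail_value X (Suc n)" for n
    unfolding \<alpha>_def complete_quotient_tail_value by (simp only: Suc_eq_plus1)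
  then have forward: "cf_inf (\<lambda>i. real_of_int (partial_quotient \<alpha> (n + 1 + i))) = real (X (Suc n)) + tail_value X (Suc (Suc n))" for n
    using inverse_tail_value[of "Suc n"] by (rule trans)
  show ?thesis unfolding \<alpha>_def[symmetric] rho_def backward forward ..
qed

end


section \<open>The sequence of digits\<close>

lemma max_digit_le_4: "max_digit s \<le> 4" by (simp add: max_digit_def)

lemma admissible_seq_state:
  assumes "admissible_seq U"
  shows "\<exists>\<sigma>. \<sigma> 0 = 1 \<and> (\<forall>j. \<sigma> (Suc j) = overlap (\<sigma> j) (U j) \<and> 1 \<le> U j \<and> U j \<le> max_digit (\<sigma> j))"
proof (rule exI[of _ "\<lambda>j. word_state (map U [0..<j])"], intro conjI allI)
  show "word_state (map U [0..<0]) = 1" by (simp add: word_state_def)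
  fix j
  show "word_state (map U [0..<Suc j]) = overlap (word_state (map U [0..<j])) (U j)"
    using word_state_snoc[of "map U [0..<j]" "U j"] by simp
  have "admissible (map U [0..<Suc j])" using assms by (simp only: admissible_seq_def)
  then have "admissible (map U [0..<j] @ [U j])" by simp
  then show "1 \<le> U j" "U j \<le> max_digit (word_state (map U [0..<j]))" by (simp_all add: admissible_snoc)
qed

lemma admissible_seq_avoids:
  assumes "admissible_seq U"
  shows "1 \<le> U j" "U j \<le> 4" "U 0 \<le> 3" "U j = 4 \<Longrightarrow> U (j + 1) \<noteq> 4"
    "U j = 4 \<Longrightarrow> U (j + 1) = 1 \<Longrightarrow> U (j + 2) = 4 \<Longrightarrow> U (j + 3) = 1 \<Longrightarrow> U (j + 4) \<noteq> 4"
    "U 0 = 1 \<Longrightarrow> U 1 = 4 \<Longrightarrow> U 2 = 1 \<Longrightarrow> U 3 \<noteq> 4"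
proof -
  obtain \<sigma> where \<sigma>: "\<sigma> 0 = 1" "\<And>j. \<sigma> (Suc j) = overlap (\<sigma> j) (U j)" "\<And>j. 1 \<le> U j"
    "\<And>j. U j \<le> max_digit (\<sigma> j)"
    using admissible_seq_state[OF assms] by blast
  show "1 \<le> U j" by (rule \<sigma>(3))
  show "U j \<le> 4" using \<sigma>(4)[of j] max_digit_le_4 le_trans by blast
  show "U 0 \<le> 3" using \<sigma>(4)[of 0] \<sigma>(1) by (simp add: max_digit_def)
  have after4: "\<sigma> (Suc j) = 1 \<or> \<sigma> (Suc j) = 3" if "U j = 4" for j
    using \<sigma>(2)[of j] that by (simp split: if_splits)
  show "U (j + 1) \<noteq> 4" if "U j = 4"
    using after4[OF that] \<sigma>(4)[of "Suc j"] by (auto simp: max_digit_def)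
  have no: "U (Suc (Suc (Suc j))) \<noteq> 4" if "\<sigma> j = 1 \<or> \<sigma> j = 3" "U j = 1" "U (Suc j) = 4" "U (Suc (Suc j)) = 1" for j
  proof -
    have 1: "\<sigma> (Suc j) = 2 \<or> \<sigma> (Suc j) = 4" using \<sigma>(2)[of j] that(1,2) by auto
    have "\<sigma> (Suc j) = 2" using 1 \<sigma>(4)[of "Suc j"] that(3) by (auto simp: max_digit_def)
    then have "\<sigma> (Suc (Suc j)) = 3" using \<sigma>(2)[of "Suc j"] that(3) by simp
    then have "\<sigma> (Suc (Suc (Suc j))) = 4" using \<sigma>(2)[of "Suc (Suc j)"] that(4) by simp
    then show ?thesis using \<sigma>(4)[of "Suc (Suc (Suc j))"] by (auto simp: max_digit_def)
  qed
  show "U (j + 4) \<noteq> 4" if "U j = 4" "U (j + 1) = 1" "U (j + 2) = 4" "U (j + 3) = 1"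
    using no[OF after4[OF that(1)]] that by (simp add: numeral_eq_Suc)
  show "U 3 \<noteq> 4" if "U 0 = 1" "U 1 = 4" "U 2 = 1"
    using no[of 0] \<sigma>(1) that by (simp add: numeral_eq_Suc)
qed

text \<open>The remainders \<open>t\<close> and \<open>t'\<close> are arbitrary because a window is
  cut off after finitely many digits and unrelated digits follow on either side.\<close>

locale peak =
  fixes a b :: nat and U V :: "nat \<Rightarrow> nat" and z :: real
  assumes a4: "4 \<le> a" and b4: "4 \<le> b" and U: "admissible_seq U" and V: "admissible_seq V" and z: "0 < z"
    and value_close: "\<And>j t t'. 0 \<le> t \<Longrightarrow> t \<le> 1 \<Longrightarrow> 0 \<le> t' \<Longrightarrow> t' \<le> 1 \<Longrightarrow>
      \<bar>log_val (real a) (map U [0..<j]) t + log_val (real b) (map V [0..<j]) t' - ln z\<bar> \<le> 2 * (1/2) ^ j"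
begin

definition S :: "int \<Rightarrow> nat" where
  "S k = (if k < 0 then U (nat (- k - 1)) else if k = 0 then a else if k = 1 then b else V (nat (k - 2)))"

text \<open>The positions \<open>n\<close> with \<open>r\<^sup>2 < n + 1 < (r + 1)\<^sup>2\<close> carry the window of radius \<open>r\<close> of the bi-infinite
  word \<open>S\<close>, centred at \<open>n + 1 = r\<^sup>2 + r\<close>; perfect squares carry the separator 2.\<close>

definition X :: "nat \<Rightarrow> nat" where
  "X n = (let r = floor_sqrt (n + 1) in
     if n + 1 = r^2 then 2 else S (int (n + 1) - int (r^2 + r)))"

definition P :: "nat \<Rightarrow> real" where
  "P n = (real (X n) + tailcf (rev (map X [0..<n])) 0) * (real (X (Suc n)) + tail_value X (Suc (Suc n)))"

definition centre :: "nat \<Rightarrow> nat" where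
  "centre r = r^2 + r - 1"

lemma X_separator: "1 \<le> r \<Longrightarrow> X (r^2 - 1) = 2"
  by (simp add: X_def)

lemma X_window:
  assumes "r^2 < n + 1" "n + 1 < (r + 1)^2"
  shows "X n = S (int (n + 1) - int (r^2 + r))"
proof -
  have "floor_sqrt (n + 1) = r" using assms by (intro floor_sqrt_unique) auto
  then show ?thesis using assms by (simp add: X_def)
qed

lemma S_pos: "1 \<le> S k"
  using a4 b4 admissible_seq_avoids(1)[OF U] admissible_seq_avoids(1)[OF V] by (simp add: S_def)

lemma S_le: "k \<noteq> 0 \<Longrightarrow> k \<noteq> 1 \<Longrightarrow> S k \<le> 4"
  using admissible_seq_avoids(2)[OF U] admissible_seq_avoids(2)[OF V] by (simp add: S_def)

lemma S_near: "S (- 1) \<le> 3" "S 2 \<le> 3"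
  using admissible_seq_avoids(3)[OF U] admissible_seq_avoids(3)[OF V] by (simp_all add: S_def)

lemma S_not_44:
  assumes "k \<le> - 2 \<or> 2 \<le> k"
  shows "\<not> (S k = 4 \<and> S (k + 1) = 4)"
proof (cases "k \<le> - 2")
  case True
  then have "nat (- k - 1) = nat (- (k + 1) - 1) + 1" by simp
  then show ?thesis using True admissible_seq_avoids(4)[OF U, of "nat (- (k + 1) - 1)"] by (auto simp: S_def)
next
  case False
  then have "nat (k + 1 - 2) = nat (k - 2) + 1" using assms by simp
  then show ?thesis using False assms admissible_seq_avoids(4)[OF V, of "nat (k - 2)"] by (auto simp: S_def)
qed

text \<open>An occurrence containing both peak digits would contain \<open>44\<close>. One that ends
  or starts at a single peak digit is excluded because the words start in state 1; the pattern is a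
  palindrome, so reading \<open>U\<close> backwards is harmless.\<close>

lemma S_not_41414:
  assumes ab: "a = 4" "b = 4"
  shows "\<not> (S k = 4 \<and> S (k + 1) = 1 \<and> S (k + 2) = 4 \<and> S (k + 3) = 1 \<and> S (k + 4) = 4)"
proof -
  have S01: "S 0 = 4" "S 1 = 4" unfolding S_def using ab by simp_all
  consider "k \<le> - 5" | "k = - 4" | "k \<in> {-3, -2, -1, 0}" | "k = 1" | "2 \<le> k" by fastforce
  then show ?thesis
  proof cases
    case 1
    define j where "j = nat (- k - 5)"
    have "S k = U (j + 4)" "S (k + 1) = U (j + 3)" "S (k + 2) = U (j + 2)" "S (k + 3) = U (j + 1)" "S (k + 4) = U j"
      using 1 by (auto simp: S_def j_def intro!: arg_cong[of _ _ U])
    then show ?thesis using admissible_seq_avoids(5)[OF U, of j] by metis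
  next
    case 2
    have "nat 3 = 3" "nat 2 = 2" by simp_all
    then have "S k = U 3" "S (k + 1) = U 2" "S (k + 2) = U 1" "S (k + 3) = U 0"
      using 2 by (simp_all add: S_def)
    then show ?thesis using admissible_seq_avoids(6)[OF U] by metis
  next
    case 3
    then show ?thesis using S01 by auto
  next
    case 4
    have "nat 3 = 3" "nat 2 = 2" by simp_all
    then have "S (k + 4) = V 3" "S (k + 3) = V 2" "S (k + 2) = V 1" "S (k + 1) = V 0"
      using 4 by (simp_all add: S_def)
    then show ?thesis using admissible_seq_avoids(6)[OF V] by metis
  next
    case 5
    define j where "j = nat (k - 2)"
    have "S k = V j" "S (k + 1) = V (j + 1)" "S (k + 2) = V (j + 2)" "S (k + 3) = V (j + 3)" "S (k + 4) = V (j + 4)"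
      using 5 by (auto simp: S_def j_def intro!: arg_cong[of _ _ V])
    then show ?thesis using admissible_seq_avoids(5)[OF V, of j] by metis
  qed
qed

lemma X_pos: "1 \<le> X n"
  unfolding X_def Let_def using S_pos by simp

text \<open>The separator 2 is not a digit of the pattern, so an occurrence would lie inside one
  window.\<close>

lemma X_not_41414:
  assumes ab: "a = 4" "b = 4"
  shows "\<not> (X n = 4 \<and> X (n + 1) = 1 \<and> X (n + 2) = 4 \<and> X (n + 3) = 1 \<and> X (n + 4) = 4)"
proof
  assume p: "X n = 4 \<and> X (n + 1) = 1 \<and> X (n + 2) = 4 \<and> X (n + 3) = 1 \<and> X (n + 4) = 4"
  have nosq: "n + i + 1 \<noteq> r^2" if "i \<le> 4" for i r
  proof
    assume e: "n + i + 1 = r^2"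
    then have "1 \<le> r" by (cases r) auto
    then have "X (n + i) = 2" using X_separator[of r] e by (metis add_diff_cancel_right')
    moreover have "i = 0 \<or> i = 1 \<or> i = 2 \<or> i = 3 \<or> i = 4" using that by linarith
    ultimately show False using p by auto
  qed
  define r where "r = floor_sqrt (n + 1)"
  have r: "r^2 \<le> n + 1" "n + 1 < (r + 1)^2"
    using floor_sqrt_power2_le[of "n + 1"] Suc_floor_sqrt_power2_gt[of "n + 1"] by (simp_all add: r_def)
  have lo: "r^2 < n + 1" using r nosq[of 0 r] by simp
  have hi: "n + 4 + 1 < (r + 1)^2"
    using r(2) nosq[of 1 "r + 1"] nosq[of 2 "r + 1"] nosq[of 3 "r + 1"] nosq[of 4 "r + 1"] by simp
  define k where "k = int (n + 1) - int (r^2 + r)"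
  have w: "X (n + i) = S (k + int i)" if "i \<le> 4" for i
    using X_window[of r "n + i"] lo hi that by (simp add: k_def algebra_simps)
  have "X n = S k" "X (n + 1) = S (k + 1)" "X (n + 2) = S (k + 2)" "X (n + 3) = S (k + 3)" "X (n + 4) = S (k + 4)"
    using w[of 0] w[of 1] w[of 2] w[of 3] w[of 4] by simp_all
  then show False using p S_not_41414[OF ab, of k] by metis
qed

lemma X_not_sublist:
  assumes ab: "a = 4" "b = 4"
  shows "\<not> sublist [4,1,4,1,4] (map X [i..<j])"
proof
  assume "sublist [4,1,4,1,4] (map X [i..<j])"
  then obtain us vs where e: "map X [i..<j] = us @ [4,1,4,1,4] @ vs" by (auto simp: sublist_def)
  have l: "length us + 5 \<le> j - i" using arg_cong[OF e, of length] by simp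
  have "X (i + length us + t) = ([4,1,4,1,4] :: nat list) ! t" if t: "t < 5" for t
  proof -
    have "X (i + length us + t) = map X [i..<j] ! (length us + t)" using l t by (simp add: add.assoc)
    also have "\<dots> = ([4,1,4,1,4] :: nat list) ! t" unfolding e nth_append_length_plus
      using t by (subst nth_append) simp
    finally show ?thesis .
  qed
  from this[of 0] this[of 1] this[of 2] this[of 3] this[of 4]
  show False using X_not_41414[OF ab, of "i + length us"] by (simp add: numeral_eq_Suc)
qed

text \<open>Positions strictly between consecutive squares are exactly these offsets: a window holds
  \<open>r - 1\<close> digits of \<open>U\<close>, then \<open>a\<close>, \<open>b\<close>, and
  \<open>r - 1\<close> digits of \<open>V\<close>.\<close>

lemma X_offset:
  assumes "int n + 1 = int (r^2 + r) + k" "- int r < k" "k \<le> int r"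
  shows "X n = S k"
proof -
  have "int (r^2) < int (n + 1)" "int (n + 1) < int ((r + 1)^2)"
    using assms by (simp_all add: power2_eq_square algebra_simps)
  then have "r^2 < n + 1" "n + 1 < (r + 1)^2" by (simp_all only: of_nat_less_iff)
  then have "X n = S (int (n + 1) - int (r^2 + r))" by (rule X_window)
  moreover have "int (n + 1) - int (r^2 + r) = k" using assms(1) by simp
  ultimately show ?thesis by simp
qed

lemma centre_int: "1 \<le> r \<Longrightarrow> int (centre r) + 1 = int (r^2 + r)"
  by (simp add: centre_def of_nat_diff)

lemma X_centre:
  assumes "1 \<le> r"
  shows "X (centre r) = a" "X (Suc (centre r)) = b"
proof -
  show "X (centre r) = a"
    using X_offset[of "centre r" r 0] centre_int[OF assms] assms by (simp add: S_def)
  show "X (Suc (centre r)) = b"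
    using X_offset[of "Suc (centre r)" r 1] centre_int[OF assms] assms by (simp add: S_def)
qed

lemma backward_word:
  assumes r: "1 \<le> r"
  shows "rev (map X [0..<centre r]) = map U [0..<r - 1] @ rev (map X [0..<centre r - (r - 1)])"
proof -
  define c where "c = centre r"
  have c: "int c + 1 = int (r^2 + r)" using centre_int[OF r] by (simp add: c_def)
  have rc: "r - 1 \<le> c" by (simp add: c_def centre_def)
  have "[0..<c] = [0..<c - (r - 1)] @ [c - (r - 1)..<c]"
    using upt_add_eq_append[of 0 "c - (r - 1)" "r - 1"] rc by simp
  moreover have "rev (map X [c - (r - 1)..<c]) = map U [0..<r - 1]"
  proof (rule nth_equalityI)
    show "length (rev (map X [c - (r - 1)..<c])) = length (map U [0..<r - 1])" using rc by simp
    fix i assume "i < length (rev (map X [c - (r - 1)..<c]))"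
    then have i: "i < r - 1" using rc by simp
    then have "rev (map X [c - (r - 1)..<c]) ! i = X (c - 1 - i)"
      using rc by (simp add: rev_nth)
    also have "\<dots> = S (- 1 - int i)"
      using i rc c by (intro X_offset[of _ r]) (auto simp: of_nat_diff)
    also have "\<dots> = U i" by (simp add: S_def)
    finally show "rev (map X [c - (r - 1)..<c]) ! i = map U [0..<r - 1] ! i" using i by simp
  qed
  ultimately show ?thesis unfolding c_def[symmetric] by simp
qed

lemma forward_word:
  assumes r: "1 \<le> r"
  shows "map X [centre r + 2..<centre r + 2 + (r - 1)] = map V [0..<r - 1]"
proof (rule nth_equalityI)
  fix i assume "i < length (map X [centre r + 2..<centre r + 2 + (r - 1)])"
  then have i: "i < r - 1" by (simp del: upt_Suc)
  then have "X (centre r + 2 + i) = S (2 + int i)"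
    using centre_int[OF r] by (intro X_offset[of _ r]) auto
  then show "map X [centre r + 2..<centre r + 2 + (r - 1)] ! i = map V [0..<r - 1] ! i"
    using i by (simp add: S_def del: upt_Suc)
qed (simp del: upt_Suc)

section \<open>Products at the centres and next to them\<close>

sublocale digits X
  by unfold_locales (rule X_pos)

definition B :: "nat \<Rightarrow> real" where
  "B n = tailcf (rev (map X [0..<n])) 0"

lemma P_eq: "P n = (real (X n) + B n) * (real (X (Suc n)) + tail_value X (Suc (Suc n)))"
  by (simp add: P_def B_def)

lemma B_bounds: "0 \<le> B n" "B n \<le> 1"
  using tailcf_bounds[of "rev (map X [0..<n])" 0] X_pos by (auto simp: B_def)

lemma B_Suc: "B (Suc n) = 1 / (real (X n) + B n)"
  by (simp add: B_def)

lemma P_pos: "0 < P n"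
  using B_bounds[of n] tail_value_bounds[of "Suc (Suc n)"] X_pos[of n] X_pos[of "Suc n"]
  unfolding P_eq by (intro mult_pos_pos add_pos_nonneg) auto

lemma ln_P_centre:
  assumes r: "1 \<le> r"
  shows "\<bar>ln (P (centre r)) - ln z\<bar> \<le> 2 * (1/2) ^ (r - 1)"
proof -
  define t where "t = tailcf (rev (map X [0..<centre r - (r - 1)])) 0"
  define t' where "t' = tail_value X (centre r + 2 + (r - 1))"
  have t: "0 \<le> t" "t \<le> 1"
    using tailcf_bounds[of "rev (map X [0..<centre r - (r - 1)])" 0] X_pos by (auto simp: t_def)
  have t': "0 \<le> t'" "t' \<le> 1" unfolding t'_def by (rule tail_value_bounds)+
  have 1: "B (centre r) = tailcf (map U [0..<r - 1]) t"
    unfolding B_def backward_word[OF r] by (simp add: tailcf_append t_def)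
  have 2: "tail_value X (Suc (Suc (centre r))) = tailcf (map V [0..<r - 1]) t'"
    using tail_value_append[of "centre r + 2" "r - 1"] unfolding forward_word[OF r] t'_def by simp
  have "0 < real a + tailcf (map U [0..<r - 1]) t" "0 < real b + tailcf (map V [0..<r - 1]) t'"
    using B_bounds(1)[of "centre r"] tail_value_bounds(1)[of "Suc (Suc (centre r))"] a4 b4 unfolding 1 2
    by (auto intro: add_pos_nonneg)
  then have "ln (P (centre r)) = log_val (real a) (map U [0..<r - 1]) t + log_val (real b) (map V [0..<r - 1]) t'"
    by (simp add: P_eq X_centre[OF r] 1 2 log_val_def ln_mult)
  then show ?thesis using value_close[OF t t', of "r - 1"] by simp
qed

lemma P_centre_tendsto: "(\<lambda>r. P (centre r)) \<longlonglongrightarrow> z"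
proof -
  have "(\<lambda>r. 2 * (1/2) ^ r :: real) \<longlonglongrightarrow> 0"
    by (intro tendsto_mult_right_zero LIMSEQ_realpow_zero) auto
  then have "(\<lambda>r. \<bar>ln (P (centre (Suc r))) - ln z\<bar>) \<longlonglongrightarrow> 0"
    by (rule tendsto_sandwich[OF _ _ tendsto_const, rotated 2])
      (use ln_P_centre[of "Suc r" for r] in \<open>auto intro: always_eventually\<close>)
  then have "(\<lambda>r. ln (P (centre (Suc r))) - ln z) \<longlonglongrightarrow> 0" by (simp only: tendsto_rabs_zero_iff)
  then have "(\<lambda>r. ln (P (centre (Suc r)))) \<longlonglongrightarrow> ln z" by (simp add: LIM_zero_iff)
  then have "(\<lambda>r. exp (ln (P (centre (Suc r))))) \<longlonglongrightarrow> exp (ln z)" by (rule tendsto_exp)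
  then have "(\<lambda>r. P (centre (Suc r))) \<longlonglongrightarrow> z" using P_pos z by simp
  then show ?thesis by (rule LIMSEQ_imp_Suc)
qed

text \<open>Hence the product at a peak dominates both neighbouring products.\<close>

lemma shifted_product_le:
  fixes x y c :: real
  assumes "0 < x" "x \<le> y" "0 \<le> c"
  shows "x * (c + 1 / y) \<le> (c + 1 / x) * y"
proof -
  have "x / y \<le> y / x"
    using assms by (intro frac_le) auto
  moreover have "x * c \<le> c * y" using mult_right_mono[OF assms(2,3)] by (simp add: mult.commute)
  ultimately show ?thesis by (simp add: algebra_simps)
qed

lemma P_before_centre:
  assumes r: "1 \<le> r" and n: "Suc n = centre r"
  shows "P n \<le> P (Suc n)"
proof -
  have "X n \<le> 3"
  \<comment> \<open>The window of radius 1 consists of \<open>a\<close> and \<open>b\<close> only,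
    so the neighbour is a separator.\<close>
  proof (cases "r = 1")
    case True
    then have "n = 0" using n by (simp add: centre_def)
    then show ?thesis using X_separator[of 1] by simp
  next
    case False
    then have "X n = S (- 1)" using r n centre_int[OF r] by (intro X_offset[of _ r]) auto
    then show ?thesis using S_near by simp
  qed
  define x where "x = real (X n) + B n"
  define y where "y = real b + tail_value X (Suc (Suc (Suc n)))"
  have x: "0 < x" "x \<le> 4"
    using \<open>X n \<le> 3\<close> B_bounds[of n] X_pos[of n] by (auto simp: x_def intro: add_pos_nonneg)
  have "x \<le> y" using x b4 tail_value_bounds(1)[of "Suc (Suc (Suc n))"] by (simp add: y_def)
  then have "x * (real a + 1 / y) \<le> (real a + 1 / x) * y" by (intro shifted_product_le x) auto
  moreover have "P n = x * (real a + 1 / y)"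
    using X_centre[OF r] tail_value_step[of "Suc (Suc n)"] by (simp add: P_eq n[symmetric] x_def y_def)
  moreover have "P (Suc n) = (real a + 1 / x) * y"
    using X_centre[OF r] by (simp add: P_eq n[symmetric] x_def y_def B_Suc)
  ultimately show ?thesis by simp
qed

lemma P_after_centre:
  assumes r: "1 \<le> r"
  shows "P (Suc (centre r)) \<le> P (centre r)"
proof -
  define n where "n = centre r"
  have "X (Suc (Suc n)) \<le> 3"
  proof (cases "r = 1")
    case True
    then have "Suc (Suc n) = 2^2 - 1" by (simp add: n_def centre_def)
    then show ?thesis using X_separator[of 2] by (simp add: numeral_3_eq_3)
  next
    case False
    then have "X (Suc (Suc n)) = S 2" using r centre_int[OF r] by (intro X_offset[of _ r]) (auto simp: n_def)
    then show ?thesis using S_near by simp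
  qed
  define x where "x = real (X (Suc (Suc n))) + tail_value X (Suc (Suc (Suc n)))"
  define y where "y = real a + B n"
  have x: "0 < x" "x \<le> 4"
    using \<open>X (Suc (Suc n)) \<le> 3\<close> tail_value_bounds[of "Suc (Suc (Suc n))"] X_pos[of "Suc (Suc n)"]
    by (auto simp: x_def intro: add_pos_nonneg)
  have "x \<le> y" using x a4 B_bounds(1)[of n] by (simp add: y_def)
  then have "x * (real b + 1 / y) \<le> (real b + 1 / x) * y" by (intro shifted_product_le x) auto
  moreover have "P (Suc n) = x * (real b + 1 / y)"
    using X_centre[OF r] by (simp add: P_eq n_def[symmetric] x_def y_def B_Suc mult.commute)
  moreover have "P n = (real b + 1 / x) * y"
    using X_centre[OF r] tail_value_step[of "Suc (Suc n)"] by (simp add: P_eq n_def[symmetric] x_def y_def mult.commute)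
  ultimately show ?thesis by (simp add: n_def)
qed

lemma P_le: "P n \<le> (real (X n) + 1) * (real (X (Suc n)) + 1)"
  using B_bounds[of n] tail_value_bounds[of "Suc (Suc n)"] unfolding P_eq by (intro mult_mono) auto

lemma z_ge: "real (a * b) \<le> z"
proof (rule LIMSEQ_le_const[OF P_centre_tendsto], intro exI allI impI)
  fix r :: nat assume r: "1 \<le> r"
  have "real a * real b \<le> P (centre r)"
    unfolding P_eq X_centre[OF r]
    using B_bounds[of "centre r"] tail_value_bounds[of "Suc (Suc (centre r))"] by (intro mult_mono) auto
  then show "real (a * b) \<le> P (centre r)" by simp
qed

end


section \<open>Products away from the centres, and the limit superior\<close>

context peak
begin

lemma X_le_4:
  assumes ab: "a = 4" "b = 4"
  shows "X n \<le> 4"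
proof -
  have "S k \<le> 4" for k
  proof (cases "k = 0 \<or> k = 1")
    case True
    then show ?thesis unfolding S_def using ab by auto
  qed (use S_le in auto)
  then show ?thesis unfolding X_def Let_def by simp
qed

lemma tail_word_bounds:
  assumes ab: "a = 4" "b = 4"
  shows "B n \<le> hull_max 0 + 2 * (1/2) ^ n" "tail_value X (Suc n) \<le> hull_max 0 + 2 * (1/2) ^ k"
    "X n = 4 \<Longrightarrow> B n \<le> hull_max 1 + 2 * (1/2) ^ n"
    "X n = 4 \<Longrightarrow> tail_value X (Suc n) \<le> hull_max 1 + 2 * (1/2) ^ k"
proof -
  define u where "u = rev (map X [0..<n])"
  define v where "v = map X [Suc n..<Suc n + k]"
  have d: "\<forall>d\<in>set u. 1 \<le> d \<and> d \<le> 4" "\<forall>d\<in>set v. 1 \<le> d \<and> d \<le> 4"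
    using X_pos X_le_4[OF ab] by (auto simp: u_def v_def simp del: upt_Suc)
  have bwd: "\<not> sublist [4,1,4,1,4] (X n # u)"
  proof -
    have "X n # u = rev (map X [0..<Suc n])" by (simp add: u_def)
    \<comment> \<open>\<open>41414\<close> is a palindrome, so the hulls also bound expansions read
      backwards.\<close>
    moreover have "\<not> sublist (rev [4,1,4,1,4]) (map X [0..<Suc n])"
      using X_not_sublist[OF ab, of 0 "Suc n"] by simp
    ultimately show ?thesis by (metis rev_rev_ident sublist_rev)
  qed
  have fwd: "\<not> sublist [4,1,4,1,4] (X n # v)"
  proof -
    have "X n # v = map X [n..<Suc n + k]" by (simp add: v_def upt_conv_Cons del: upt_Suc)
    then show ?thesis using X_not_sublist[OF ab, of n "Suc n + k"] by simp
  qed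
  have nu: "\<not> sublist [4,1,4,1,4] u" "\<not> sublist [4,1,4,1,4] v"
    using bwd fwd by (meson sublist_Cons_right)+
  have len: "length u = n" "length v = k" by (simp_all add: u_def v_def del: upt_Suc)
  have B: "B n = tailcf u 0" by (simp add: B_def u_def)
  have F: "tail_value X (Suc n) = tailcf v (tail_value X (Suc n + k))"
    using tail_value_append[of "Suc n" k] by (simp only: v_def)
  show "B n \<le> hull_max 0 + 2 * (1/2) ^ n"
    using tailcf_le_hull_max[of 0 u 0] d nu len by (simp add: B)
  show "tail_value X (Suc n) \<le> hull_max 0 + 2 * (1/2) ^ k"
    using tailcf_le_hull_max[of 0 v "tail_value X (Suc n + k)"] d nu len tail_value_bounds unfolding F by simp
  show "B n \<le> hull_max 1 + 2 * (1/2) ^ n" if "X n = 4"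
    using tailcf_le_hull_max[of 1 u 0] d bwd len that by (simp add: B)
  show "tail_value X (Suc n) \<le> hull_max 1 + 2 * (1/2) ^ k" if "X n = 4"
    using tailcf_le_hull_max[of 1 v "tail_value X (Suc n + k)"] d fwd len tail_value_bounds that unfolding F by simp
qed

lemma P_ordinary_44:
  assumes ab: "a = 4" "b = 4" and n: "\<not> (X n = 4 \<and> X (Suc n) = 4)"
  shows "P n \<le> (4 + hull_max 1) * (3 + hull_max 0) + 22 * (1/2) ^ n"
proof -
  define e :: real where "e = 2 * (1/2) ^ n"
  have e: "0 \<le> e" "e \<le> 2" by (simp_all add: e_def power_le_one)
  have q: "0 < hull_max 1" "hull_max 1 < 1" "0 < hull_max 0" "hull_max 0 < 1"
    using sqrt_disc_bounds by (simp_all add: hull_max_def)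
  have big: "(4 + hull_max 1 + e) * (3 + hull_max 0 + e) \<le> (4 + hull_max 1) * (3 + hull_max 0) + 22 * (1/2) ^ n"
  proof -
    \<comment> \<open>Both hull values are below 1 and \<open>e \<le> 2\<close>, so the bracket is
      at most 11; doubled by the definition of \<open>e\<close>, this gives 22.\<close>
    have "e * (7 + hull_max 1 + hull_max 0 + e) \<le> e * 11" using e q by (intro mult_left_mono) auto
    then show ?thesis by (simp add: e_def algebra_simps)
  qed
  have low: "16 \<le> (4 + hull_max 1) * (3 + hull_max 0)"
    using sqrt_disc_bounds(1) unfolding hull_max_product sqrt_disc_def by simp
  \<comment> \<open>Only a 4 next to a 3 needs the hulls; all other pairs are bounded by 16 through
    digit plus one.\<close>
  consider "X n = 4" "X (Suc n) = 3" | "X n = 3" "X (Suc n) = 4" | "X n = 4" "X (Suc n) \<le> 2"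
    | "X n \<le> 2" "X (Suc n) = 4" | "X n \<le> 3" "X (Suc n) \<le> 3"
    using n X_le_4[OF ab, of n] X_le_4[OF ab, of "Suc n"] by linarith
  then show ?thesis
  proof cases
    case 1
    then have "P n \<le> (4 + hull_max 1 + e) * (3 + hull_max 0 + e)"
      using tail_word_bounds(3)[OF ab, of n] tail_word_bounds(2)[OF ab, of "Suc n" n] B_bounds[of n]
        tail_value_bounds[of "Suc (Suc n)"] q e unfolding P_eq by (intro mult_mono) (auto simp: e_def)
    then show ?thesis using big by simp
  next
    case 2
    then have "P n \<le> (3 + hull_max 0 + e) * (4 + hull_max 1 + e)"
      using tail_word_bounds(1)[OF ab, of n] tail_word_bounds(4)[OF ab, of "Suc n" n] B_bounds[of n]
        tail_value_bounds[of "Suc (Suc n)"] q e unfolding P_eq by (intro mult_mono) (auto simp: e_def)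
    then show ?thesis using big by (simp add: mult.commute)
  next
    case 3
    have "(real (X n) + 1) * (real (X (Suc n)) + 1) \<le> 5 * 3" using 3 by (intro mult_mono) auto
    then show ?thesis using P_le[of n] low zero_le_power[of "1/2 :: real" n] by linarith
  next
    case 4
    have "(real (X n) + 1) * (real (X (Suc n)) + 1) \<le> 3 * 5" using 4 by (intro mult_mono) auto
    then show ?thesis using P_le[of n] low zero_le_power[of "1/2 :: real" n] by linarith
  next
    case 5
    have "(real (X n) + 1) * (real (X (Suc n)) + 1) \<le> 4 * 4" using 5 by (intro mult_mono) auto
    then show ?thesis using P_le[of n] low zero_le_power[of "1/2 :: real" n] by linarith
  qed
qed

text \<open>If a peak digit exceeds 4, then \<open>z \<ge> a * b \<ge> 20\<close>, and the crude
  bound \<open>5 * 4\<close> for a background product suffices. The finer estimate is needed only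
  for \<open>a = b = 4\<close>.\<close>

lemma P_ordinary:
  assumes z: "(4 + hull_max 1) * (3 + hull_max 0) \<le> z"
    and n: "X n \<le> 4" "X (Suc n) \<le> 4" "\<not> (X n = 4 \<and> X (Suc n) = 4)"
  shows "P n \<le> z + 22 * (1/2) ^ n"
proof (cases "a = 4 \<and> b = 4")
  case True
  then show ?thesis using P_ordinary_44[of n] n(3) z by simp
next
  case False
  have "20 \<le> a * b"
    using False a4 b4 mult_le_mono[of 5 a 4 b] mult_le_mono[of 4 a 5 b] by linarith
  then have z20: "20 \<le> z" using z_ge by linarith
  have "X n = 4 \<and> X (Suc n) \<le> 3 \<or> X n \<le> 3 \<and> X (Suc n) \<le> 4" using n by linarith
  then have "(real (X n) + 1) * (real (X (Suc n)) + 1) \<le> 20"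
  proof
    assume "X n = 4 \<and> X (Suc n) \<le> 3"
    then show ?thesis using mult_mono[of "real (X n) + 1" 5 "real (X (Suc n)) + 1" 4] by simp
  next
    assume "X n \<le> 3 \<and> X (Suc n) \<le> 4"
    then show ?thesis using mult_mono[of "real (X n) + 1" 4 "real (X (Suc n)) + 1" 5] by simp
  qed
  then show ?thesis using P_le[of n] z20 zero_le_power[of "1/2 :: real" n] by linarith
qed

lemma P_le_max:
  assumes z: "(4 + hull_max 1) * (3 + hull_max 0) \<le> z"
  shows "P n \<le> max (P (centre (floor_sqrt (n + 1)))) (z + 22 * (1/2) ^ n)"
proof -
  define r where "r = floor_sqrt (n + 1)"
  have r1: "1 \<le> r" by (simp add: r_def Suc_le_eq)
  define k where "k = int n + 1 - int (r^2 + r)"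
  have "r^2 \<le> n + 1" "n + 1 < (r + 1)^2"
    using floor_sqrt_power2_le[of "n + 1"] Suc_floor_sqrt_power2_gt[of "n + 1"] by (simp_all add: r_def)
  then have "int (r^2) \<le> int (n + 1)" "int (n + 1) < int ((r + 1)^2)" by (simp_all only: of_nat_less_iff of_nat_le_iff)
  then have k: "- int r \<le> k" "k \<le> int r" by (simp_all add: k_def power2_eq_square algebra_simps)
  have nk: "int n + 1 = int (r^2 + r) + k" by (simp add: k_def)
  note c = centre_int[OF r1]
  consider "k = 0" | "k = - 1" | "k = 1" | "k \<le> - 2 \<or> 2 \<le> k" by linarith
  then have "P n \<le> max (P (centre r)) (z + 22 * (1/2) ^ n)"
  proof cases
    case 1
    then have "n = centre r" using nk c by linarith
    then show ?thesis by simp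
  next
    case 2
    then have "Suc n = centre r" using nk c by linarith
    then show ?thesis using P_before_centre[OF r1] by fastforce
  next
    case 3
    then have "n = Suc (centre r)" using nk c by linarith
    then show ?thesis using P_after_centre[OF r1] by simp
  next
    case 4
    \<comment> \<open>At the window boundary one digit of the pair is a separator: the first for
      \<open>k = - int r\<close>, the second for \<open>k = int r\<close>.\<close>
    have Xn: "X n = S k" if "k \<noteq> - int r"
      using k that nk by (intro X_offset) auto
    have Xn1: "X (Suc n) = S (k + 1)" if "k \<noteq> int r"
      using k that nk by (intro X_offset) auto
    have sep: "X n = 2" if "k = - int r"
    proof -
      have "int n + 1 = int (r^2)" using nk that by simp
      then have "n = r^2 - 1" by linarith
      then show ?thesis using X_separator[OF r1] by simp
    qed
    have sep1: "X (Suc n) = 2" if "k = int r"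
    proof -
      have "int (Suc n) = int ((r + 1)^2 - 1)" using nk that by (simp add: power2_eq_square algebra_simps)
      then have "Suc n = (r + 1)^2 - 1" by (simp only: of_nat_eq_iff)
      then show ?thesis using X_separator[of "r + 1"] by simp
    qed
    have "X n \<le> 4" using Xn sep S_le[of k] 4 by (cases "k = - int r") auto
    moreover have "X (Suc n) \<le> 4" using Xn1 sep1 S_le[of "k + 1"] 4 by (cases "k = int r") auto
    moreover have "\<not> (X n = 4 \<and> X (Suc n) = 4)"
      using Xn Xn1 sep sep1 S_not_44[OF 4] by (cases "k = - int r"; cases "k = int r") auto
    ultimately show ?thesis using P_ordinary[OF z, of n] by simp
  qed
  then show ?thesis by (simp only: r_def)
qed

lemma filterlim_floor_sqrt: "filterlim (\<lambda>n. floor_sqrt (n + 1)) at_top sequentially"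
  unfolding filterlim_at_top
proof
  fix Z :: nat
  show "\<forall>\<^sub>F n in sequentially. Z \<le> floor_sqrt (n + 1)"
    using eventually_ge_at_top[of "Z^2"] by eventually_elim (simp add: le_floor_sqrt_iff)
qed

lemma limsup_P:
  assumes z: "(4 + hull_max 1) * (3 + hull_max 0) \<le> z"
  shows "limsup (\<lambda>n. ereal (P n)) = ereal z"
proof (rule antisym)
  define h where "h n = max (P (centre (floor_sqrt (n + 1)))) (z + 22 * (1/2) ^ n)" for n
  have "(\<lambda>n. z + 22 * (1/2) ^ n) \<longlonglongrightarrow> z + 22 * 0"
    by (intro tendsto_intros LIMSEQ_realpow_zero) auto
  then have "h \<longlonglongrightarrow> max z z"
    unfolding h_def
    by (intro tendsto_max filterlim_compose[OF P_centre_tendsto filterlim_floor_sqrt]) simp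
  then have "limsup (\<lambda>n. ereal (h n)) = ereal z"
    by (intro lim_imp_Limsup) auto
  moreover have "P n \<le> h n" for n using P_le_max[OF z, of n] by (simp only: h_def)
  then have "limsup (\<lambda>n. ereal (P n)) \<le> limsup (\<lambda>n. ereal (h n))"
    by (intro Limsup_mono always_eventually) simp
  ultimately show "limsup (\<lambda>n. ereal (P n)) \<le> ereal z" by simp
next
  have "strict_mono (\<lambda>r. centre (Suc r))"
    unfolding strict_mono_Suc_iff by (simp add: centre_def power2_eq_square)
  then have "limsup ((\<lambda>n. ereal (P n)) \<circ> (\<lambda>r. centre (Suc r))) \<le> limsup (\<lambda>n. ereal (P n))"
    by (rule limsup_subseq_mono)
  moreover have "limsup ((\<lambda>n. ereal (P n)) \<circ> (\<lambda>r. centre (Suc r))) = ereal z"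
    using LIMSEQ_Suc[OF P_centre_tendsto] by (intro lim_imp_Limsup) (auto simp: o_def)
  ultimately show "ereal z \<le> limsup (\<lambda>n. ereal (P n))" by simp
qed

lemma mem_Omega_bar:
  assumes "(4 + hull_max 1) * (3 + hull_max 0) \<le> z"
  shows "z \<in> Omega_bar"
proof -
  have "rho (1 / tail_value X 0) = ereal z"
    using limsup_P[OF assms] unfolding rho_inverse_tail_value P_def .
  then show ?thesis using inverse_tail_value_irrational by (auto simp: Omega_bar_def)
qed

end

theorem theorem1p3:
  "mu \<le> ereal ((19425 + 111 * sqrt 26565) / 2030)"
proof -
  define m :: real where "m = (19425 + 111 * sqrt 26565) / 2030"
  have "{m..} \<subseteq> Omega_bar"
  proof
    fix z assume "z \<in> {m..}"
    then have mz: "m \<le> z" by simp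
    have z: "182 / 10 \<le> z"
      using mz sqrt_disc_bounds(1) unfolding m_def sqrt_disc_def by (simp add: field_simps)
    obtain a b U V where "4 \<le> a" "4 \<le> b" "admissible_seq U" "admissible_seq V"
      and close: "\<And>j t t'. 0 \<le> t \<Longrightarrow> t \<le> 1 \<Longrightarrow> 0 \<le> t' \<Longrightarrow> t' \<le> 1 \<Longrightarrow>
        \<bar>log_val (real a) (map U [0..<j]) t + log_val (real b) (map V [0..<j]) t' - ln z\<bar> \<le> 2 * (1/2) ^ j"
      using peak_exists[OF z] by blast
    then interpret peak a b U V z
      using z by unfold_locales auto
    show "z \<in> Omega_bar"
      using mem_Omega_bar mz unfolding hull_max_product m_def by simp
  qed
  then have "mu \<le> ereal m" unfolding mu_def by (intro INF_lower) simp
  then show ?thesis by (simp add: m_def)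
qed

end
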